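(* For $\tau$ in the complex upper half-plane $\mathbb{H}$, put $q=e^{2\pi i\tau}$ and $q^{\alpha}:=e^{2\pi i\alpha\tau}$ for rational $\alpha$. Let \[ \Pi_q:=q^{1/4}\frac{(q^2;q^2)_\infty^2}{(q;q^2)_\infty^2},\qquad \Pi_{q^7}:=q^{7/4}\frac{(q^{14};q^{14})_\infty^2}{(q^{7};q^{14})_\infty^2}, \] and \[ z:=\frac{1}{\Pi_{q^7}^2}\left(\sum_{n\ge1}\frac{q^{2n-1}}{(1-q^{2n-1})^2}-7\sum_{n\ge1}\frac{q^{14n-7}}{(1-q^{14n-7})^2}\right). \] Then \[ z^3+4\frac{\Pi_q}{\Pi_{q^7}}z^2-3\frac{\Pi_q^2}{\Pi_{q^7}^2}z-\frac{\Pi_q}{\Pi_{q^7}}\left(\frac{\Pi_q^4}{\Pi_{q^7}^4}+4\frac{\Pi_q^2}{\Pi_{q^7}^2}+49\right)=0. \]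
   Context: For a complex number $a$, $(a;q)_\infty:=\prod_{n=0}^\infty(1-aq^n)$. *)

theory Defs
  imports "HOL-Analysis.Analysis"
begin

(* The branch of q^alpha is fixed by tau, not by the value of q = exp (2 pi i tau). *)
definition q_power :: "complex \<Rightarrow> rat \<Rightarrow> complex" where
  "q_power \<tau> \<alpha> = exp (2 * of_real pi * \<i> * of_rat \<alpha> * \<tau>)"

definition qpoch_inf :: "complex \<Rightarrow> complex \<Rightarrow> complex" where
  "qpoch_inf a q = (\<Prod>n. 1 - a * q ^ n)"

definition Pi_q :: "complex \<Rightarrow> complex" where
  "Pi_q \<tau> = (let q = q_power \<tau> 1 in
     q_power \<tau> (1/4) * (qpoch_inf (q^2) (q^2))^2 / (qpoch_inf q (q^2))^2)"

definition Pi_q7 :: "complex \<Rightarrow> complex" where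
  "Pi_q7 \<tau> = (let q = q_power \<tau> 1 in
     q_power \<tau> (7/4) * (qpoch_inf (q^14) (q^14))^2 / (qpoch_inf (q^7) (q^14))^2)"

(* In the two series the index n of suminf starts at 0, so that Suc n runs
   over the positive integers; the truncated subtractions are exact. *)
definition z_fun :: "complex \<Rightarrow> complex" where
  "z_fun \<tau> = (let q = q_power \<tau> 1 in
     1 / (Pi_q7 \<tau>)^2 *
       ((\<Sum>n. q ^ (2 * Suc n - 1) / (1 - q ^ (2 * Suc n - 1))^2)
        - 7 * (\<Sum>n. q ^ (14 * Suc n - 7) / (1 - q ^ (14 * Suc n - 7))^2)))"

end

(* Put phi(q) = sum q^(n^2) and
   psi(q) = (1/2) sum q^(n(n+1)/2), sums over all integers n. The triple product gives
   Pi_q = q^(1/4) psi(q)^2 and, by logarithmic differentiation of the product for phi(-q),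
   q d/dq log phi(-q) = -2 S(q), where S(q) is the first Lambert series of the theorem; so
   W = S(q) - 7 S(q^7) is half the logarithmic derivative of phi(-q^7)/phi(-q).
   Rearranging double theta series gives the classical relations between phi and psi, their
   logarithmic derivatives, and, by arithmetic in the ring of integers of Q(sqrt(-7)), the
   modular equation of degree 7
     phi(q) phi(q^7) = phi(-q^2) phi(-q^14) + 2 q psi(q) psi(q^7).
   Differentiating it once gives the multiplier and differentiating it again gives W. With
   t = 2 q psi(q) psi(q^7) / (phi(q) phi(q^7)) one finds
     W = (phi(q) phi(q^7))^2 t (2 - t + 2 t^2) / 4,
   first near q = 0, where a sign can be fixed; the cubic relation then extends to the unit
   disc by analytic continuation. *)
theory Submission
  imports Defs "HOL-Complex_Analysis.Complex_Analysis"
begin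

section \<open>The Gaussian binomial theorem\<close>

text \<open>For q d/dq, every logarithmic derivative used consists of Lambert series plus a linear
  combination of 1 and fourth powers of theta functions. In the first derivative of the modular
  equation the Lambert parts form a common summand, which cancels by the equation itself, so W
  cannot be seen there. In the second derivative they survive only as a difference, and this
  difference is W up to a factor. The rest is algebra with alpha = 16 q psi(q^2)^4 / phi(q)^4 and
  beta = alpha(q^7), where t^8 = alpha beta and (1 - t)^8 = (1 - alpha)(1 - beta). Degree 7 is
  special: Cauchy's identity (a + b)^7 - a^7 - b^7 = 7 a b (a + b) (a^2 + a b + b^2)^2 at a = t, b =
  1 - t makes the square of t phi(q)^4 - 16 q psi(q^2)^4 the square of a polynomial in t and phi(q)
  phi(q^7). Everything then becomes rational in t, up to the one sign. The derivative formula
  linking phi(q) and psi(q^2) comes from squaring Jacobi's series for the cube of the Euler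
  product.\<close>

definition qfac :: "complex \<Rightarrow> nat \<Rightarrow> complex" where
  "qfac q n = (\<Prod>k<n. 1 - q * q ^ k)"

definition gauss_binom :: "complex \<Rightarrow> nat \<Rightarrow> nat \<Rightarrow> complex" where
  "gauss_binom q n k = qfac q n / (qfac q k * qfac q (n - k))"

abbreviation euler_fun :: "complex \<Rightarrow> complex" where
  "euler_fun q \<equiv> qpoch_inf q q"

lemma one_minus_power_nonzero:
  fixes q :: complex
  assumes "norm q < 1"
  shows "1 - q * q ^ k \<noteq> 0"
proof -
  have "norm (q ^ Suc k) < 1"
    unfolding norm_power using assms by (simp only: power_less_one_iff norm_ge_zero zero_less_Suc)
  then show ?thesis by auto
qed

lemma qfac_0 [simp]: "qfac q 0 = 1"
  and qfac_Suc: "qfac q (Suc n) = qfac q n * (1 - q * q ^ n)"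
  by (simp_all add: qfac_def)

lemma qfac_nonzero: "norm q < 1 \<Longrightarrow> qfac q n \<noteq> 0"
  using one_minus_power_nonzero by (simp add: qfac_def)

lemma convergent_prod_qpoch:
  assumes "norm (q::complex) < 1"
  shows "convergent_prod (\<lambda>n. 1 - a * q ^ n)"
proof -
  have "summable (\<lambda>n. norm (1 - a * q ^ n - 1))"
    using assms by (simp add: norm_mult norm_power summable_mult summable_geometric)
  then show ?thesis
    using abs_convergent_prod_conv_summable abs_convergent_prod_imp_convergent_prod by blast
qed

lemma qpoch_LIMSEQ:
  assumes "norm q < 1"
  shows "(\<lambda>n. \<Prod>k<n. 1 - a * q ^ k) \<longlonglongrightarrow> qpoch_inf a q"
proof -
  have "(\<lambda>n. \<Prod>k\<le>n. 1 - a * q ^ k) \<longlonglongrightarrow> qpoch_inf a q"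
    unfolding qpoch_inf_def by (rule convergent_prod_LIMSEQ[OF convergent_prod_qpoch[OF assms]])
  then show ?thesis
    by (subst (asm) lessThan_Suc_atMost[symmetric]) (rule filterlim_sequentially_Suc[THEN iffD1])
qed

lemma qpoch_nonzero:
  assumes "norm q < 1" "\<And>k. a * q ^ k \<noteq> 1"
  shows "qpoch_inf a q \<noteq> 0"
  unfolding qpoch_inf_def
  by (rule prodinf_nonzero[OF convergent_prod_qpoch[OF assms(1)]]) (use assms(2) in \<open>metis right_minus_eq\<close>)

lemma euler_nonzero: "norm q < 1 \<Longrightarrow> euler_fun q \<noteq> 0"
  using one_minus_power_nonzero[of q] by (intro qpoch_nonzero) (metis right_minus_eq)+

lemma qfac_LIMSEQ: "norm q < 1 \<Longrightarrow> qfac q \<longlonglongrightarrow> euler_fun q"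
  unfolding qfac_def by (rule qpoch_LIMSEQ)

lemma gauss_binom_0 [simp]: "norm q < 1 \<Longrightarrow> gauss_binom q n 0 = 1"
  and gauss_binom_self [simp]: "norm q < 1 \<Longrightarrow> gauss_binom q n n = 1"
  by (simp_all add: gauss_binom_def qfac_nonzero)

text \<open>Pascal's rule rests on 1 - q^(n+1) = (1 - q^(n-k)) + q^(n-k) (1 - q^(k+1)). The case k =
  n is excluded: truncated subtraction gives \<open>gauss_binom q n (Suc n)\<close> a nonzero value,
  so the top coefficient is treated apart below.\<close>

lemma gauss_binom_Suc:
  assumes q: "norm q < 1" and "k < n"
  shows "gauss_binom q (Suc n) (Suc k) = gauss_binom q n (Suc k) + q ^ (n - k) * gauss_binom q n k"
proof -
  obtain d where n: "n = Suc (k + d)"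
    using \<open>k < n\<close> less_imp_Suc_add by blast
  define u v where "u = 1 - q * q ^ k" and "v = 1 - q * q ^ d"
  have nz: "qfac q k \<noteq> 0" "qfac q d \<noteq> 0" "u \<noteq> 0" "v \<noteq> 0"
    unfolding u_def v_def by (intro qfac_nonzero one_minus_power_nonzero q)+
  have 1: "gauss_binom q n (Suc k) = qfac q n / (qfac q k * u * qfac q d)"
    by (simp only: gauss_binom_def n qfac_Suc[of q k] u_def diff_Suc_Suc add_diff_cancel_left')
  have 2: "gauss_binom q n k = qfac q n / (qfac q k * (qfac q d * v))"
    by (simp add: gauss_binom_def n qfac_Suc[of q d] v_def Suc_diff_le)
  have "Suc n - Suc k = Suc d"
    by (simp add: n)
  then have 3: "gauss_binom q (Suc n) (Suc k) = qfac q n * (1 - q * q ^ n) / (qfac q k * u * (qfac q d * v))"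
    by (simp only: gauss_binom_def qfac_Suc u_def v_def)
  have 4: "1 - q * q ^ n = v + q ^ Suc d * u"
    by (simp add: u_def v_def n power_add algebra_simps)
  have 5: "n - k = Suc d"
    by (simp add: n)
  show ?thesis
    unfolding 1 2 3 4 5 using nz by (simp add: field_simps)
qed

text \<open>Induction on n by Pascal's rule. Writing q^n = q^(n-k) q^k in the new factor 1 - y q^n
  supplies both the Pascal weight and the increment k of the triangular exponent.\<close>

theorem q_binomial:
  assumes q: "norm q < 1"
  shows "(\<Prod>k<n. 1 - y * q ^ k) = (\<Sum>k\<le>n. gauss_binom q n k * (-y) ^ k * q ^ (k * (k - 1) div 2))"
proof (induction n)
  case 0
  show ?case using q by simp
next
  case (Suc n)
  define c where "c n k = gauss_binom q n k * (-y) ^ k * q ^ (k * (k - 1) div 2)" for n k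
  have tri: "Suc k * (Suc k - 1) div 2 = k * (k - 1) div 2 + k" for k :: nat
  proof -
    have "Suc k * (Suc k - 1) = k * (k - 1) + k * 2"
      by (cases k) (auto simp: algebra_simps)
    then show ?thesis by simp
  qed
  have step: "c (Suc n) (Suc k) = c n (Suc k) + c n k * (- y * q ^ n)" if "k < n" for k
  proof -
    have "q ^ n = q ^ (n - k) * q ^ k"
      using that by (simp flip: power_add)
    then show ?thesis
      unfolding c_def tri using gauss_binom_Suc[OF q that] by (simp add: power_add algebra_simps)
  qed
  have top: "c (Suc n) (Suc n) = c n n * (- y * q ^ n)"
    unfolding c_def tri using q by (simp add: power_add algebra_simps)
  have "(\<Prod>k<Suc n. 1 - y * q ^ k) = (\<Sum>k\<le>n. c n k) * (1 - y * q ^ n)"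
    using Suc by (simp add: c_def)
  also have "\<dots> = (\<Sum>k\<le>n. c n k) + (\<Sum>k\<le>n. c n k * (- y * q ^ n))"
    by (simp add: algebra_simps sum_distrib_left sum_negf)
  also have "(\<Sum>k\<le>n. c n k) = c n 0 + (\<Sum>k<n. c n (Suc k))"
    by (simp only: lessThan_Suc_atMost[symmetric] sum.lessThan_Suc_shift)
  also have "(\<Sum>k\<le>n. c n k * (- y * q ^ n)) = (\<Sum>k<n. c n k * (- y * q ^ n)) + c n n * (- y * q ^ n)"
    by (simp only: lessThan_Suc_atMost[symmetric] sum.lessThan_Suc)
  also have "c n 0 + (\<Sum>k<n. c n (Suc k)) + \<dots> = c (Suc n) 0 + ((\<Sum>k<n. c (Suc n) (Suc k)) + c (Suc n) (Suc n))"
  proof -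
    have "(\<Sum>k<n. c (Suc n) (Suc k)) = (\<Sum>k<n. c n (Suc k)) + (\<Sum>k<n. c n k * (- y * q ^ n))"
      unfolding sum.distrib[symmetric] by (intro sum.cong refl step) auto
    moreover have "c (Suc n) 0 = c n 0"
      using q by (simp add: c_def)
    ultimately show ?thesis
      by (simp only: top ac_simps)
  qed
  also have "\<dots> = (\<Sum>k\<le>Suc n. c (Suc n) k)"
    by (simp only: sum.atMost_Suc_shift) (simp only: lessThan_Suc_atMost[symmetric] sum.lessThan_Suc)
  finally show ?case by (simp add: c_def)
qed

lemma even_pronic: "even ((j::int) * (j - 1))" "even ((j::int) * (j + 1))"
  by auto

text \<open>The q-binomial theorem with 2N factors at y = z q^(-N). The upper half of the factors is
  the product in z; the lower half, read backwards, is the product in q/z up to a monomial, which is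
  then cancelled against the sum.\<close>

lemma finite_triple_product:
  assumes q: "norm q < 1" "q \<noteq> 0" and z: "z \<noteq> 0"
  shows "(\<Prod>k<N. 1 - z * q ^ k) * (\<Prod>k<N. 1 - q * q ^ k / z) =
    (\<Sum>j\<in>{-int N..int N}. (-z) powi j * q ^ nat (j * (j - 1) div 2) * gauss_binom q (2 * N) (nat (int N + j)))"
proof -
  define y where "y = z * q powi (- int N)"
  have "(\<Prod>k<2*N. 1 - y * q ^ k) = (\<Prod>k<N. 1 - y * q ^ k) * (\<Prod>k\<in>{N..<2*N}. 1 - y * q ^ k)"
    by (subst prod.union_disjoint[symmetric]) (auto intro!: prod.cong)
  also have "(\<Prod>k\<in>{N..<2*N}. 1 - y * q ^ k) = (\<Prod>k<N. 1 - z * q ^ k)"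
  proof (rule prod.reindex_bij_witness[of _ "\<lambda>k. k + N" "\<lambda>k. k - N"])
    fix k assume "k \<in> {N..<2*N}"
    then have "q ^ k = q ^ (k - N) * q ^ N"
      by (simp flip: power_add)
    then show "1 - z * q ^ (k - N) = 1 - y * q ^ k"
      using q by (simp add: y_def power_int_minus field_simps)
  qed auto
  also have "(\<Prod>k<N. 1 - y * q ^ k) = (\<Prod>k<N. 1 - z / (q * q ^ k))"
  proof (rule prod.reindex_bij_witness[of _ "\<lambda>k. N - 1 - k" "\<lambda>k. N - 1 - k"])
    fix k assume "k \<in> {..<N}"
    then have "q ^ N = q ^ k * q ^ (N - 1 - k) * q"
      by (simp flip: power_add power_Suc2)
    then show "1 - z / (q * q ^ (N - 1 - k)) = 1 - y * q ^ k"
      using q by (simp add: y_def power_int_minus field_simps)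
  qed auto
  also have "\<dots> = (\<Prod>k<N. (- z / (q * q ^ k)) * (1 - q * q ^ k / z))"
    using q z by (intro prod.cong) (auto simp: field_simps)
  also have "\<dots> = (-z) ^ N * q powi (- (int N * (int N + 1) div 2)) * (\<Prod>k<N. 1 - q * q ^ k / z)"
  proof -
    have "(\<Prod>k<N. - z / (q * q ^ k)) = (-z) ^ N * q powi (- (int N * (int N + 1) div 2))"
    proof (induction N)
      case (Suc N)
      have e: "int (Suc N) * (int (Suc N) + 1) div 2 = int N * (int N + 1) div 2 + (int N + 1)"
      proof -
        have "int (Suc N) * (int (Suc N) + 1) = int N * (int N + 1) + (int N + 1) * 2"
          by (simp add: algebra_simps)
        then show ?thesis by simp
      qed
      have "q powi (- (int N * (int N + 1) div 2) + - (int N + 1))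
        = q powi (- (int N * (int N + 1) div 2)) * q powi (- (int N + 1))"
        using q by (subst power_int_add) auto
      moreover have "q powi (- (int N + 1)) = 1 / (q * q ^ N)"
      proof -
        have "- (int N + 1) = - int (Suc N)" by simp
        then show ?thesis
          by (simp only: power_int_minus power_int_of_nat power_Suc inverse_eq_divide)
      qed
      ultimately show ?case
        unfolding e using Suc q by (simp add: algebra_simps)
    qed auto
    then show ?thesis by (simp only: prod.distrib)
  qed
  finally have L: "(\<Prod>k<2*N. 1 - y * q ^ k) = (-z) ^ N * q powi (- (int N * (int N + 1) div 2)) *
      ((\<Prod>k<N. 1 - z * q ^ k) * (\<Prod>k<N. 1 - q * q ^ k / z))"
    by (simp add: ac_simps)
  have "(\<Sum>k\<le>2*N. gauss_binom q (2*N) k * (-y) ^ k * q ^ (k * (k - 1) div 2)) =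
     (\<Sum>j\<in>{-int N..int N}. (-z) ^ N * q powi (- (int N * (int N + 1) div 2)) *
       ((-z) powi j * q ^ nat (j * (j - 1) div 2) * gauss_binom q (2 * N) (nat (int N + j))))"
  proof (rule sum.reindex_bij_witness[of _ "\<lambda>j. nat (int N + j)" "\<lambda>k. int k - int N"])
    fix k assume "k \<in> {..2*N}"
    define j where "j = int k - int N"
    have k: "int k = int N + j" by (simp add: j_def)
    have tk: "int (k * (k - 1) div 2) = int k * (int k - 1) div 2"
      by (cases k) (auto simp: zdiv_int algebra_simps)
    \<comment> \<open>With k = N + j, the power q^(-N k) hidden in y^k and the triangular power of
      the q-binomial theorem combine to the monomial of the product side times q^(j(j-1)/2).\<close>
    have e: "- (int N * (int N + 1) div 2) + j * (j - 1) div 2 = - (int N * int k) + int k * (int k - 1) div 2"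
    proof -
      have "2 * (int N * (int N + 1) div 2) = int N * (int N + 1)" "2 * (j * (j - 1) div 2) = j * (j - 1)"
        "2 * (int k * (int k - 1) div 2) = int k * (int k - 1)"
        using even_pronic by (auto intro!: dvd_mult_div_cancel)
      moreover have "- (int N * (int N + 1)) + j * (j - 1) = - 2 * (int N * int k) + int k * (int k - 1)"
        by (simp add: k algebra_simps)
      ultimately show ?thesis by linarith
    qed
    have jj: "j * (j - 1) div 2 \<ge> 0"
      by (auto simp: zero_le_mult_iff intro!: div_int_pos_iff[THEN iffD2])
    have "(-y) ^ k * q ^ (k * (k - 1) div 2) = (-z) ^ k * (q powi (- (int N * int k)) * q powi int (k * (k - 1) div 2))"
      unfolding y_def using q 
      by (simp add: power_mult_distrib power_int_power power_int_minus power_mult field_simps flip: of_nat_mult)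
         (simp flip: power_mult_distrib)
    also have "q powi (- (int N * int k)) * q powi int (k * (k - 1) div 2)
       = q powi (- (int N * (int N + 1) div 2) + j * (j - 1) div 2)"
      using q unfolding e tk by (subst power_int_add) auto
    also have "\<dots> = q powi (- (int N * (int N + 1) div 2)) * q ^ nat (j * (j - 1) div 2)"
    proof -
      have "q ^ nat (j * (j - 1) div 2) = q powi (j * (j - 1) div 2)"
        using jj by (simp add: power_int_def)
      then show ?thesis
        using q power_int_add[of q "- (int N * (int N + 1) div 2)" "j * (j - 1) div 2"] by simp
    qed
    also have "(-z) ^ k = (-z) ^ N * (-z) powi j"
      using z power_int_add[of "-z" "int N" j] by (simp flip: k)
    finally show "(-z) ^ N * q powi (- (int N * (int N + 1) div 2)) *
       ((-z) powi (int k - int N) * q ^ nat ((int k - int N) * (int k - int N - 1) div 2) * gauss_binom q (2 * N) (nat (int N + (int k - int N))))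
      = gauss_binom q (2*N) k * (-y) ^ k * q ^ (k * (k - 1) div 2)"
      by (simp add: j_def)
  qed auto
  with L q_binomial[OF q(1), where y = y and n = "2 * N"] show ?thesis
    using q z by (simp add: sum_distrib_left[symmetric] mult.assoc)
qed

section \<open>Sums over the integers and passage to the limit\<close>

lemma summable_on_intI:
  fixes f :: "int \<Rightarrow> complex"
  assumes "summable (\<lambda>n. norm (f (int n)))" "summable (\<lambda>n. norm (f (- int n)))"
  shows "f summable_on UNIV"
proof -
  have U: "(UNIV :: int set) = range int \<union> range (\<lambda>n. - int n)"
    by (metis (no_types, lifting) UNIV_eq_I UnCI int_cases2 rangeI)
  have "f summable_on range int"
    by (subst summable_on_reindex) (auto intro!: norm_summable_imp_summable_on assms simp: inj_on_def o_def)
  moreover have "f summable_on range (\<lambda>n. - int n)"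
    by (subst summable_on_reindex) (auto intro!: norm_summable_imp_summable_on assms simp: inj_on_def o_def)
  ultimately show ?thesis
    unfolding U by (rule summable_on_union)
qed

lemma summable_square_geometric:
  fixes r :: real
  assumes "0 \<le> r" "r < 1"
  shows "summable (\<lambda>n. (1 + real n)^2 * r ^ n)"
proof -
  have 1: "summable (\<lambda>n. diffs (\<lambda>_. 1) n * x ^ n)" if "norm x < 1" for x :: real
    using that by (intro termdiff_converges[where K = 1]) (auto intro!: summable_geometric)
  have "summable (\<lambda>n. diffs (diffs (\<lambda>_. 1)) n * r ^ n)"
    using assms 1 by (intro termdiff_converges[where K = 1]) auto
  then show ?thesis
    by (rule summable_comparison_test'[of _ 0])
       (use assms in \<open>auto simp: diffs_def power2_eq_square intro!: mult_right_mono mult_mono\<close>)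
qed

text \<open>Comparison with n^2 r^n. Quadratic weights are allowed because q d/dq brings down
  exponents such as n^2; the offset 1 in the growth condition is what triangular numbers require (n
  = -1 has exponent 0).\<close>

lemma theta_summable:
  fixes e :: "int \<Rightarrow> nat" and q :: complex
  assumes q: "norm q < 1" and e: "\<And>n. nat \<bar>n\<bar> \<le> e n + 1"
    and a: "\<And>n. norm (a n) \<le> C * (1 + \<bar>real_of_int n\<bar>)^2"
  shows "(\<lambda>n. a n * q ^ e n) summable_on UNIV"
proof -
  \<comment> \<open>The maximum keeps r positive even for q = 0: one power of r is divided off to
    absorb the offset 1.\<close>
  define r where "r = max (norm q) (1/2)"
  have r: "0 < r" "r < 1" "norm q \<le> r"
    using q by (auto simp: r_def)
  have C: "C \<ge> 0"
    using a[of 0] order_trans[OF norm_ge_zero] by fastforce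
  have *: "norm (a n * q ^ e n) \<le> C / r * ((1 + real (nat \<bar>n\<bar>))^2 * r ^ nat \<bar>n\<bar>)" for n
  proof -
    have "norm (q ^ e n) \<le> r ^ e n"
      using r by (simp add: norm_power power_mono)
    also have "\<dots> = r ^ (e n + 1) / r"
      using r by simp
    also have "\<dots> \<le> r ^ nat \<bar>n\<bar> / r"
      using r e[of n] by (intro divide_right_mono power_decreasing) auto
    finally have "norm (a n) * norm (q ^ e n) \<le> (C * (1 + \<bar>real_of_int n\<bar>)^2) * (r ^ nat \<bar>n\<bar> / r)"
      using a[of n] C by (intro mult_mono) auto
    then show ?thesis
      by (simp add: norm_mult)
  qed
  have s: "summable (\<lambda>n. C / r * ((1 + real n)^2 * r ^ n))"
    using r by (intro summable_mult summable_square_geometric) auto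
  show ?thesis
    by (rule summable_on_intI; rule summable_comparison_test'[OF s, of 0])
       (use *[of "int n" for n] *[of "- int n" for n] in auto)
qed

lemma infsum_times:
  fixes f :: "'a \<Rightarrow> complex" and g :: "'b \<Rightarrow> complex"
  assumes "f summable_on A" "g summable_on B"
  shows "((\<lambda>(x, y). f x * g y) has_sum (infsum f A * infsum g B)) (A \<times> B)"
proof (rule has_sum_SigmaI)
  show "((\<lambda>y. case (x, y) of (x, y) \<Rightarrow> f x * g y) has_sum f x * infsum g B) B" for x
    using assms by (auto intro!: has_sum_cmult_right)
  show "((\<lambda>x. f x * infsum g B) has_sum infsum f A * infsum g B) A"
    using assms by (auto intro!: has_sum_cmult_left)
  have af: "(\<lambda>x. norm (f x)) summable_on A" and ag: "(\<lambda>y. norm (g y)) summable_on B"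
    using assms[THEN summable_on_iff_abs_summable_on_complex[THEN iffD1]] .
  have "(\<lambda>(x, y). norm (f x) * norm (g y)) summable_on A \<times> B"
  proof (rule summable_on_SigmaI)
    show "((\<lambda>y. case (x, y) of (x, y) \<Rightarrow> norm (f x) * norm (g y)) has_sum
        norm (f x) * infsum (\<lambda>y. norm (g y)) B) B" for x
      using ag by (auto intro!: has_sum_cmult_right)
    show "(\<lambda>x. norm (f x) * infsum (\<lambda>y. norm (g y)) B) summable_on A"
      using af by (rule summable_on_cmult_left)
  qed auto
  then show "(\<lambda>(x, y). f x * g y) summable_on A \<times> B"
    by (subst summable_on_iff_abs_summable_on_complex) (simp add: case_prod_unfold norm_mult)
qed

lemma sums_int_decode:
  fixes c :: "int \<Rightarrow> complex"
  assumes "c summable_on UNIV"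
  shows "summable (\<lambda>k. norm (c (int_decode k)))" "(\<lambda>k. c (int_decode k)) sums infsum c UNIV"
proof -
  have b: "bij_betw int_decode UNIV UNIV"
    by (rule bij_int_decode)
  have "(\<lambda>j. norm (c j)) summable_on UNIV"
    using assms by (rule summable_on_iff_abs_summable_on_complex[THEN iffD1])
  then show "summable (\<lambda>k. norm (c (int_decode k)))"
    using summable_on_reindex_bij_betw[OF b, of "\<lambda>j. norm (c j)"] summable_on_imp_summable by blast
  show "(\<lambda>k. c (int_decode k)) sums infsum c UNIV"
    using has_sum_reindex_bij_betw[OF b, of c "infsum c UNIV"] assms has_sum_imp_sums by auto
qed

text \<open>Tannery's theorem, transported to \<open>\<nat>\<close> along a bijection.\<close>
lemma gauss_binom_sum_LIMSEQ:
  assumes q: "norm q < 1" and c: "c summable_on UNIV"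
  shows "(\<lambda>N. \<Sum>j\<in>{-int N..int N}. c j * gauss_binom q (2 * N) (nat (int N + j)))
    \<longlonglongrightarrow> infsum c UNIV / euler_fun q"
proof -
  note E = qfac_LIMSEQ[OF q] and E0 = euler_nonzero[OF q]
  obtain K where K: "\<And>n. norm (qfac q n) \<le> K"
    using convergent_imp_Bseq[of "qfac q"] E by (auto simp: Bseq_def convergent_def)
  have "(\<lambda>n. inverse (qfac q n)) \<longlonglongrightarrow> inverse (euler_fun q)"
    by (intro tendsto_inverse E E0)
  then obtain L where L: "\<And>n. norm (inverse (qfac q n)) \<le> L"
    using convergent_imp_Bseq[of "\<lambda>n. inverse (qfac q n)"] by (auto simp: Bseq_def convergent_def)
  have KL: "K \<ge> 0" "L \<ge> 0"
    using K[of 0] L[of 0] by auto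
  \<comment> \<open>The limit of \<open>qfac q\<close> is nonzero, so its reciprocals are bounded as
    well; this dominates all Gaussian binomials at once.\<close>
  have bound: "norm (gauss_binom q n k) \<le> K * (L * L)" for n k
  proof -
    have "norm (gauss_binom q n k) = norm (qfac q n) * (norm (inverse (qfac q k)) * norm (inverse (qfac q (n - k))))"
      by (simp add: gauss_binom_def norm_divide norm_mult norm_inverse divide_inverse)
    also have "\<dots> \<le> K * (L * L)"
      using KL by (intro mult_mono K L) auto
    finally show ?thesis .
  qed
  have lim: "(\<lambda>N. gauss_binom q (2 * N) (nat (int N + j))) \<longlonglongrightarrow> 1 / euler_fun q" for j
  proof -
    have t: "filterlim (\<lambda>N. nat (int N + i)) sequentially sequentially" for i
      unfolding filterlim_at_top eventually_sequentially
    proof safe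
      fix Z show "\<exists>N. \<forall>n\<ge>N. Z \<le> nat (int n + i)"
        by (rule exI[of _ "Z + nat \<bar>i\<bar>"]) linarith
    qed
    have d: "filterlim (\<lambda>N. 2 * N) sequentially (sequentially :: nat filter)"
      by (intro filterlim_subseq strict_monoI) auto
    have "(\<lambda>N. qfac q (2 * N) / (qfac q (nat (int N + j)) * qfac q (nat (int N + (- j)))))
        \<longlonglongrightarrow> euler_fun q / (euler_fun q * euler_fun q)"
      using E0 by (intro tendsto_intros filterlim_compose[OF E t] filterlim_compose[OF E d]) auto
    moreover have "\<forall>\<^sub>F N in sequentially. qfac q (2 * N) / (qfac q (nat (int N + j)) * qfac q (nat (int N + (- j))))
        = gauss_binom q (2 * N) (nat (int N + j))"
      unfolding gauss_binom_def eventually_sequentially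
    proof (intro exI[of _ "nat \<bar>j\<bar>"] allI impI)
      fix N assume "nat \<bar>j\<bar> \<le> N"
      then have "nat (int N + (- j)) = 2 * N - nat (int N + j)" by linarith
      then show "qfac q (2 * N) / (qfac q (nat (int N + j)) * qfac q (nat (int N + (- j))))
        = qfac q (2 * N) / (qfac q (nat (int N + j)) * qfac q (2 * N - nat (int N + j)))" by simp
    qed
    ultimately show ?thesis
      using E0 tendsto_cong by fastforce
  qed
  \<comment> \<open>Extension by zero turns the truncated sums into series over one fixed index
    set.\<close>
  define a where "a k N = (if \<bar>int_decode k\<bar> \<le> int N
     then c (int_decode k) * gauss_binom q (2 * N) (nat (int N + int_decode k)) else 0)" for k N
  have "(\<lambda>N. \<Sum>k. a k N) \<longlonglongrightarrow> (\<Sum>k. c (int_decode k) * (1 / euler_fun q))"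
  proof (rule tannerys_theorem[THEN conjunct2, THEN conjunct2])
    show "(\<lambda>N. a k N) \<longlonglongrightarrow> c (int_decode k) * (1 / euler_fun q)" for k
    proof (rule Lim_transform_eventually)
      show "(\<lambda>N. c (int_decode k) * gauss_binom q (2 * N) (nat (int N + int_decode k)))
          \<longlonglongrightarrow> c (int_decode k) * (1 / euler_fun q)"
        by (intro tendsto_intros lim)
      show "\<forall>\<^sub>F N in sequentially. c (int_decode k) * gauss_binom q (2 * N) (nat (int N + int_decode k)) = a k N"
        unfolding eventually_sequentially a_def by (rule exI[of _ "nat \<bar>int_decode k\<bar>"]) auto
    qed
    show "\<forall>\<^sub>F (k, N) in sequentially \<times>\<^sub>F sequentially. norm (a k N) \<le> norm (c (int_decode k)) * (K * (L * L))"
      using bound KL by (intro always_eventually) (auto simp: a_def norm_mult intro!: mult_left_mono)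
    show "summable (\<lambda>k. norm (c (int_decode k)) * (K * (L * L)))"
      by (intro summable_mult2 sums_int_decode c)
  qed auto
  moreover have "(\<Sum>k. c (int_decode k) * (1 / euler_fun q)) = infsum c UNIV / euler_fun q"
    using sums_mult2[OF sums_int_decode(2)[OF c], of "1 / euler_fun q"] by (simp add: sums_iff)
  moreover have "(\<Sum>k. a k N) = (\<Sum>j\<in>{-int N..int N}. c j * gauss_binom q (2 * N) (nat (int N + j)))" for N
  proof -
    have "(\<Sum>k. a k N) = (\<Sum>k\<in>int_encode ` {-int N..int N}. a k N)"
      by (rule suminf_finite) (auto simp: a_def image_iff dest!: bspec[where x = "int_decode k" for k])
    also have "\<dots> = (\<Sum>j\<in>{-int N..int N}. a (int_encode j) N)"
      by (subst sum.reindex) (auto intro: inj_on_subset[OF inj_int_encode])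
    also have "\<dots> = (\<Sum>j\<in>{-int N..int N}. c j * gauss_binom q (2 * N) (nat (int N + j)))"
      by (intro sum.cong) (auto simp: a_def)
    finally show ?thesis .
  qed
  ultimately show ?thesis by simp
qed

section \<open>The triple product and theta functions\<close>

definition phi :: "complex \<Rightarrow> complex" where
  "phi q = (\<Sum>\<^sub>\<infinity>n::int. q ^ nat (n^2))"

text \<open>The indices n and -1-n give the same triangular number, hence the half. The bilateral
  form is kept because the rearrangements below act on whole lattices.\<close>

definition psi :: "complex \<Rightarrow> complex" where
  "psi q = (\<Sum>\<^sub>\<infinity>n::int. q ^ nat (n * (n + 1) div 2)) / 2"

definition alt :: "int \<Rightarrow> complex" where
  "alt n = (if even n then 1 else -1)"

lemma norm_alt [simp]: "norm (alt n) = 1"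
  by (simp add: alt_def)

lemma abs_le_square: "\<bar>n::int\<bar> \<le> n^2"
proof (cases "n = 0")
  case False
  then have "\<bar>n\<bar> * 1 \<le> \<bar>n\<bar> * \<bar>n\<bar>"
    by (intro mult_left_mono) auto
  then show ?thesis by (simp add: power2_eq_square abs_mult)
qed auto

lemma two_tri: "2 * (n * (n + 1) div 2) = n * (n + 1)" "2 * (n * (n - 1) div 2) = n * (n - 1)" for n :: int
  using even_pronic by (auto intro!: dvd_mult_div_cancel)

lemma tri_nonneg: "0 \<le> n * (n + 1) div 2" "0 \<le> n * (n - 1) div 2" for n :: int
  by (auto simp: zero_le_mult_iff intro!: div_int_pos_iff[THEN iffD2])

lemma abs_le_tri: "\<bar>n::int\<bar> \<le> n * (n + 1) div 2 + 1" "\<bar>n::int\<bar> \<le> n * (n - 1) div 2 + 1"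
proof -
  have "2 * \<bar>n\<bar> \<le> n * (n + 1) + 2" "2 * \<bar>n\<bar> \<le> n * (n - 1) + 2"
  proof -
    have "0 \<le> (n - 1) * (n - 2) \<or> n \<le> 0" "0 \<le> (n + 1) * (n + 2) \<or> 0 \<le> n" "0 \<le> n * n"
      by (auto simp: zero_le_mult_iff)
    moreover have "0 \<le> n * (n - 1)" "0 \<le> n * (n + 1)"
      by (auto simp: zero_le_mult_iff)
    ultimately show "2 * \<bar>n\<bar> \<le> n * (n + 1) + 2" "2 * \<bar>n\<bar> \<le> n * (n - 1) + 2"
      by (auto simp: algebra_simps abs_if)
  qed
  then show "\<bar>n::int\<bar> \<le> n * (n + 1) div 2 + 1" "\<bar>n::int\<bar> \<le> n * (n - 1) div 2 + 1"
    using two_tri[of n] by linarith+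
qed

lemma nat_exponent_bounds:
  "nat \<bar>n\<bar> \<le> nat (n^2) + 1" "nat \<bar>n\<bar> \<le> nat (n * (n + 1) div 2) + 1"
  "nat \<bar>n\<bar> \<le> nat (n * (n - 1) div 2) + 1" "nat \<bar>n\<bar> \<le> nat (n * (n + 1)) + 1"
  using abs_le_square[of n] abs_le_tri[of n] two_tri[of n] tri_nonneg[of n] by linarith+

lemma weight_bounds:
  "norm (1::complex) \<le> 1 * (1 + \<bar>real_of_int n\<bar>)^2" "norm (alt n) \<le> 1 * (1 + \<bar>real_of_int n\<bar>)^2"
  "norm (of_int n * alt n) \<le> 1 * (1 + \<bar>real_of_int n\<bar>)^2"
proof -
  have "1 \<le> 1 + \<bar>real_of_int n\<bar>" "\<bar>real_of_int n\<bar> \<le> 1 + \<bar>real_of_int n\<bar>" "0 \<le> \<bar>real_of_int n\<bar>"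
    by auto
  then have "1 * 1 \<le> (1 + \<bar>real_of_int n\<bar>) * (1 + \<bar>real_of_int n\<bar>)"
     "\<bar>real_of_int n\<bar> * 1 \<le> (1 + \<bar>real_of_int n\<bar>) * (1 + \<bar>real_of_int n\<bar>)"
    by (intro mult_mono; simp)+
  then show "norm (1::complex) \<le> 1 * (1 + \<bar>real_of_int n\<bar>)^2" "norm (alt n) \<le> 1 * (1 + \<bar>real_of_int n\<bar>)^2"
    "norm (of_int n * alt n) \<le> 1 * (1 + \<bar>real_of_int n\<bar>)^2"
    by (simp_all add: power2_eq_square norm_mult)
qed

lemma theta_series_summable:
  assumes "norm (q::complex) < 1"
  shows "(\<lambda>n::int. q ^ nat (n^2)) summable_on UNIV"
    and "(\<lambda>n::int. q ^ nat (n * (n + 1) div 2)) summable_on UNIV"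
    and "(\<lambda>n::int. q ^ nat (n * (n - 1) div 2)) summable_on UNIV"
    and "(\<lambda>n::int. q ^ nat (n * (n + 1))) summable_on UNIV"
    and "(\<lambda>n::int. alt n * q ^ nat (n^2)) summable_on UNIV"
    and "(\<lambda>n::int. alt n * q ^ nat (n * (n + 1))) summable_on UNIV"
    and "(\<lambda>n::int. alt n * q ^ nat (n * (n + 1) div 2)) summable_on UNIV"
    and "(\<lambda>n::int. of_int n * alt n * q ^ nat (n * (n + 1) div 2)) summable_on UNIV"
    and "(\<lambda>n::int. of_int n * alt n * q ^ nat (n * (n - 1) div 2)) summable_on UNIV"
  using theta_summable[OF assms nat_exponent_bounds(1) weight_bounds(1)]
    theta_summable[OF assms nat_exponent_bounds(2) weight_bounds(1)]
    theta_summable[OF assms nat_exponent_bounds(3) weight_bounds(1)]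
    theta_summable[OF assms nat_exponent_bounds(4) weight_bounds(1)]
    theta_summable[OF assms nat_exponent_bounds(1) weight_bounds(2)]
    theta_summable[OF assms nat_exponent_bounds(4) weight_bounds(2)]
    theta_summable[OF assms nat_exponent_bounds(2) weight_bounds(2)]
    theta_summable[OF assms nat_exponent_bounds(2) weight_bounds(3)]
    theta_summable[OF assms nat_exponent_bounds(3) weight_bounds(3)]
  by simp_all

lemma norm_power_less_1: "norm (q::complex) < 1 \<Longrightarrow> 0 < n \<Longrightarrow> norm (q ^ n) < 1"
  by (simp add: norm_power power_less_one_iff)

lemma power_minus_square: "(-q) ^ nat (n^2) = alt n * (q::complex) ^ nat (n^2)"
proof -
  have "even (nat (n^2)) \<longleftrightarrow> even n"
    by (simp add: even_nat_iff)
  then show ?thesis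
    by (cases "even n") (simp_all add: alt_def)
qed

section \<open>Product formulas for phi(-q) and psi(q), and the cube of the Euler product\<close>

lemma euler_split_odd:
  assumes "norm q < 1"
  shows "euler_fun q = qpoch_inf q (q^2) * euler_fun (q^2)"
proof -
  have q2: "norm (q^2) < 1"
    using assms by (rule norm_power_less_1) simp
  have d: "filterlim (\<lambda>N. 2 * N) sequentially (sequentially :: nat filter)"
    by (intro filterlim_subseq strict_monoI) auto
  have "(\<lambda>n. \<Prod>k<2*n. 1 - q * q ^ k) \<longlonglongrightarrow> euler_fun q"
    by (rule filterlim_compose[OF qpoch_LIMSEQ[OF assms] d])
  moreover have "(\<Prod>k<2*n. 1 - q * q ^ k) = (\<Prod>k<n. 1 - q * (q^2) ^ k) * (\<Prod>k<n. 1 - q^2 * (q^2) ^ k)" for n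
  proof (induction n)
    case (Suc n)
    have "2 * Suc n = Suc (Suc (2 * n))" "q * q ^ (2 * n) = q * (q^2) ^ n" "q * q ^ Suc (2 * n) = q^2 * (q^2) ^ n"
      by (simp_all add: power_mult power2_eq_square)
    then show ?case
      by (simp only: prod.lessThan_Suc Suc.IH) (simp only: mult_ac)
  qed simp
  ultimately show ?thesis
    using tendsto_mult[OF qpoch_LIMSEQ[OF q2, of q] qpoch_LIMSEQ[OF q2, of "q^2"]] LIMSEQ_unique by simp
qed

lemma euler_double:
  assumes "norm q < 1"
  shows "euler_fun (q^2) = qpoch_inf (-q) q * euler_fun q"
proof -
  have q2: "norm (q^2) < 1"
    using assms by (rule norm_power_less_1) simp
  have "(\<Prod>k<n. 1 - q^2 * (q^2) ^ k) = (\<Prod>k<n. 1 - (-q) * q ^ k) * (\<Prod>k<n. 1 - q * q ^ k)" for n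
    unfolding prod.distrib[symmetric]
    by (intro prod.cong) (simp_all add: algebra_simps power2_eq_square power_mult_distrib)
  then show ?thesis
    using tendsto_mult[OF qpoch_LIMSEQ[OF assms, of "-q"] qpoch_LIMSEQ[OF assms, of q]]
      qpoch_LIMSEQ[OF q2, of "q^2"] LIMSEQ_unique by simp
qed

text \<open>Limit of \<open>finite_triple_product\<close>, the Gaussian binomials tending to 1 /
  \<open>euler_fun q\<close>. Summability is assumed because \<open>theta_summable\<close> covers
  polynomial weights only; each application first rewrites its terms into that form.\<close>

lemma triple_product:
  assumes q: "norm q < 1" "q \<noteq> 0" and z: "z \<noteq> 0"
    and c: "(\<lambda>j. (-z) powi j * q ^ nat (j * (j - 1) div 2)) summable_on UNIV"
  shows "qpoch_inf z q * qpoch_inf (q / z) q * euler_fun q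
    = (\<Sum>\<^sub>\<infinity>j. (-z) powi j * q ^ nat (j * (j - 1) div 2))"
proof -
  have "(\<lambda>N. (\<Prod>k<N. 1 - z * q ^ k) * (\<Prod>k<N. 1 - q / z * q ^ k)) \<longlonglongrightarrow> qpoch_inf z q * qpoch_inf (q / z) q"
    by (intro tendsto_mult qpoch_LIMSEQ q)
  moreover have "(\<Prod>k<N. 1 - z * q ^ k) * (\<Prod>k<N. 1 - q / z * q ^ k) =
    (\<Sum>j\<in>{-int N..int N}. (-z) powi j * q ^ nat (j * (j - 1) div 2) * gauss_binom q (2 * N) (nat (int N + j)))" for N
    using finite_triple_product[OF q z, of N] by (simp add: field_simps)
  ultimately show ?thesis
    using gauss_binom_sum_LIMSEQ[OF q(1) c] euler_nonzero[OF q(1)] LIMSEQ_unique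
    by (fastforce simp: field_simps)
qed

text \<open>Triple product with base q^2 at z = q, where the exponent is j + j(j-1) = j^2.\<close>

lemma phi_minus_eq:
  assumes q: "norm q < 1" "q \<noteq> 0"
  shows "phi (-q) * euler_fun (q^2) = euler_fun q ^ 2"
proof -
  have q2: "norm (q^2) < 1" "q^2 \<noteq> 0"
    using q norm_power_less_1[of q 2] by auto
  have e: "(-q) powi j * (q^2) ^ nat (j * (j - 1) div 2) = alt j * q ^ nat (j^2)" for j
  proof -
    have "(q^2) ^ nat k = q ^ nat (2 * k)" for k
      by (simp add: power_mult[symmetric] nat_mult_distrib)
    then have "(q^2) ^ nat (j * (j - 1) div 2) = q ^ nat (2 * (j * (j - 1) div 2))" .
    also have "\<dots> = q powi (j * (j - 1))"
    proof -
      have "0 \<le> j * (j - 1)"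
        by (auto simp: zero_le_mult_iff)
      then show ?thesis
        unfolding two_tri by (simp add: power_int_def)
    qed
    finally have "(-q) powi j * (q^2) ^ nat (j * (j - 1) div 2) = alt j * (q powi j * q powi (j * (j - 1)))"
      by (simp add: power_int_minus_left alt_def)
    also have "q powi j * q powi (j * (j - 1)) = q powi (j^2)"
      using q by (simp add: power_int_add[symmetric] algebra_simps power2_eq_square)
    finally show ?thesis
      by (simp add: power_int_def)
  qed
  have "qpoch_inf q (q^2) * qpoch_inf q (q^2) * euler_fun (q^2) = (\<Sum>\<^sub>\<infinity>j. alt j * q ^ nat (j^2))"
    using triple_product[OF q2 q(2)] theta_series_summable(5)[OF q(1)] q(2) unfolding e
    by (simp add: power2_eq_square)
  then have "phi (-q) = qpoch_inf q (q^2) * qpoch_inf q (q^2) * euler_fun (q^2)"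
    by (simp add: phi_def power_minus_square)
  then show ?thesis
    by (simp add: euler_split_odd[OF q(1)] power2_eq_square)
qed

lemma tri_shift:
  "(\<Sum>\<^sub>\<infinity>j::int. f j * q ^ nat (j * (j - 1) div 2)) = (\<Sum>\<^sub>\<infinity>j::int. f (j + 1) * (q::complex) ^ nat (j * (j + 1) div 2))"
  by (rule infsum_reindex_bij_witness[of _ "\<lambda>j. j + 1" "\<lambda>j. j - 1"]) (auto simp: mult.commute)

text \<open>Triple product at z = -1: the first factor of \<open>qpoch_inf (-1) q\<close> equals 2,
  which matches the double counting in the bilateral series.\<close>

lemma psi_eq:
  assumes q: "norm q < 1" "q \<noteq> 0"
  shows "psi q * euler_fun q = euler_fun (q^2) ^ 2"
proof -
  have half: "qpoch_inf (-q) q = qpoch_inf (-1) q / 2"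
    using prodinf_split_head[OF convergent_prod_qpoch[OF q(1), of "-1"]] by (simp add: qpoch_inf_def)
  have 1: "qpoch_inf (-1) q = 2 * qpoch_inf (-q) q"
    unfolding half by simp
  have "qpoch_inf (-1) q * qpoch_inf (-q) q * euler_fun q = (\<Sum>\<^sub>\<infinity>j::int. 1 * q ^ nat (j * (j - 1) div 2))"
    using triple_product[OF q, of "-1"] theta_series_summable(3)[OF q(1)] by simp
  also have "\<dots> = 2 * psi q"
    by (subst tri_shift) (simp add: psi_def)
  finally have psi: "qpoch_inf (-q) q * qpoch_inf (-q) q * euler_fun q = psi q"
    by (simp add: 1 mult.assoc)
  show ?thesis
    unfolding psi[symmetric] euler_double[OF q(1)] by (simp add: power2_eq_square)
qed

text \<open>Differentiate the triple product at z = 1, where the factor 1 - z vanishes, so that only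
  minus the product of the other factors remains. Doing this for the finite product and letting N
  grow afterwards avoids any exchange of limit and derivative.\<close>

lemma euler_cubed_aux:
  assumes q: "norm q < 1" "q \<noteq> 0"
  shows "(\<Sum>\<^sub>\<infinity>j::int. of_int j * alt j * q ^ nat (j * (j - 1) div 2)) = - (euler_fun q ^ 3)"
proof -
  have fin: "- (qfac q M * qfac q (Suc M)) =
     (\<Sum>j\<in>{-int (Suc M)..int (Suc M)}. of_int j * alt j * q ^ nat (j * (j - 1) div 2) *
        gauss_binom q (2 * Suc M) (nat (int (Suc M) + j)))" for M
  proof -
    define N where "N = Suc M"
    \<comment> \<open>H is the product without its factor 1 - z; N = \<open>Suc M\<close> ensures
      that this factor is present.\<close>
    define H where "H z = (\<Prod>k<M. 1 - z * (q * q ^ k)) * (\<Prod>k<N. 1 - q * q ^ k / z)" for z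
    define c where "c j = q ^ nat (j * (j - 1) div 2) * gauss_binom q (2 * N) (nat (int N + j))" for j
    define R where "R z = (\<Sum>j\<in>{-int N..int N}. (-z) powi j * c j)" for z
    have "H holomorphic_on - {0}"
      unfolding H_def by (intro holomorphic_intros) auto
    then have "(H has_field_derivative deriv H 1) (at 1)"
      by (rule holomorphic_derivI) auto
    then have "((\<lambda>z. (1 - z) * H z) has_field_derivative - H 1) (at 1)"
      by (auto intro!: derivative_eq_intros)
    moreover have "(R has_field_derivative (\<Sum>j\<in>{-int N..int N}. of_int j * alt j * c j)) (at 1)"
    proof -
      have "((\<lambda>z. (-z) powi j * c j) has_field_derivative of_int j * alt j * c j) (at 1)" for j
      proof -
        have "((\<lambda>z::complex. z powi j) has_field_derivative of_int j) (at 1)"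
          by (auto intro!: derivative_eq_intros)
        then have "((\<lambda>z::complex. alt j * z powi j * c j) has_field_derivative alt j * of_int j * c j) (at 1)"
          by (intro DERIV_cmult DERIV_cmult_right)
        then show ?thesis
          by (simp add: power_int_minus_left alt_def mult_ac if_distrib if_distribR cong: if_cong)
      qed
      then show ?thesis
        unfolding R_def by (intro DERIV_sum)
    qed
    moreover have "R z = (1 - z) * H z" if "z \<in> - {0}" for z
      using finite_triple_product[OF q, of z N] that
      by (simp add: R_def H_def c_def N_def prod.lessThan_Suc_shift mult.assoc del: prod.lessThan_Suc)
    ultimately have "- H 1 = (\<Sum>j\<in>{-int N..int N}. of_int j * alt j * c j)"
      using has_field_derivative_transform_within_open[of R _ 1 "- {0}" "\<lambda>z. (1 - z) * H z"] DERIV_unique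
      by (metis (no_types, lifting) ComplI empty_iff insert_iff open_delete open_UNIV Compl_eq_Diff_UNIV zero_neq_one)
    then show ?thesis
      by (simp add: H_def N_def qfac_def c_def mult.assoc del: prod.lessThan_Suc)
  qed
  have "(\<lambda>M. - (qfac q M * qfac q (Suc M))) \<longlonglongrightarrow> - (euler_fun q * euler_fun q)"
    by (intro tendsto_intros qfac_LIMSEQ[OF q(1)] LIMSEQ_Suc)
  moreover have "(\<lambda>M. - (qfac q M * qfac q (Suc M))) \<longlonglongrightarrow>
    (\<Sum>\<^sub>\<infinity>j::int. of_int j * alt j * q ^ nat (j * (j - 1) div 2)) / euler_fun q"
    unfolding fin by (rule LIMSEQ_Suc[OF gauss_binom_sum_LIMSEQ[OF q(1) theta_series_summable(9)[OF q(1)]]])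
  ultimately have "(\<Sum>\<^sub>\<infinity>j::int. of_int j * alt j * q ^ nat (j * (j - 1) div 2)) / euler_fun q
     = - (euler_fun q * euler_fun q)"
    using LIMSEQ_unique by blast
  then show ?thesis
    using euler_nonzero[OF q(1)] by (simp add: field_simps power3_eq_cube)
qed

text \<open>The reflection j to -1-j shows that the weights j and j + 1 give the same sum. Adding
  both gives Jacobi's identity, doubled because the sum runs over all integers.\<close>

lemma euler_cubed:
  assumes q: "norm q < 1" "q \<noteq> 0"
  shows "(\<Sum>\<^sub>\<infinity>j::int. of_int (2 * j + 1) * alt j * q ^ nat (j * (j + 1) div 2)) = 2 * euler_fun q ^ 3"
proof -
  let ?t = "\<lambda>j. alt j * q ^ nat (j * (j + 1) div 2)"
  note s = theta_series_summable[OF q(1)]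
  have s1: "(\<lambda>j. of_int j * ?t j) summable_on UNIV"
    using s(8) by (simp add: mult.assoc)
  have s2: "(\<lambda>j. of_int (j + 1) * ?t j) summable_on UNIV"
    using summable_on_add[OF s1 s(7)] by (simp add: algebra_simps)
  have "(\<Sum>\<^sub>\<infinity>j. of_int (j + 1) * alt (j + 1) * q ^ nat (j * (j + 1) div 2)) = - (euler_fun q ^ 3)"
    using euler_cubed_aux[OF q] by (subst (asm) tri_shift) simp
  moreover have "of_int (j + 1) * alt (j + 1) * q ^ nat (j * (j + 1) div 2) = - (of_int (j + 1) * ?t j)" for j
    by (simp add: alt_def algebra_simps)
  ultimately have e2: "(\<Sum>\<^sub>\<infinity>j. of_int (j + 1) * ?t j) = euler_fun q ^ 3"
    by (simp only: infsum_uminus) simp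
  also have "(\<Sum>\<^sub>\<infinity>j. of_int (j + 1) * ?t j) = (\<Sum>\<^sub>\<infinity>j. of_int j * ?t j)"
    by (rule infsum_reindex_bij_witness[of _ "\<lambda>j. - 1 - j" "\<lambda>j. - 1 - j"]) (auto simp: alt_def algebra_simps)
  finally have "(\<Sum>\<^sub>\<infinity>j. of_int j * ?t j + of_int (j + 1) * ?t j) = 2 * euler_fun q ^ 3"
    using infsum_add[OF s1 s2] e2 by simp
  then show ?thesis
    by (simp add: algebra_simps)
qed

section \<open>Relations between theta functions\<close>

lemma half_sum_diff:
  fixes m n :: int
  shows "even (m + n) \<Longrightarrow> (m + n) div 2 + (m - n) div 2 = m"
    and "even (m + n) \<Longrightarrow> (m + n) div 2 - (m - n) div 2 = n"
    and "odd (m + n) \<Longrightarrow> (m + n - 1) div 2 + (m - n - 1) div 2 + 1 = m"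
    and "odd (m + n) \<Longrightarrow> (m + n - 1) div 2 - (m - n - 1) div 2 = n"
  by presburger+

text \<open>The points (u + v, u - v) form the sublattice of pairs of equal parity, the points (u +
  v + 1, u - v) its other coset. The quadratic theta relations of this section are this
  decomposition applied to a product of two series.\<close>

lemma parity_split:
  fixes F :: "int \<times> int \<Rightarrow> complex"
  assumes "F summable_on UNIV"
  shows "infsum F UNIV = (\<Sum>\<^sub>\<infinity>(u, v). F (u + v, u - v)) + (\<Sum>\<^sub>\<infinity>(u, v). F (u + v + 1, u - v))"
proof -
  let ?E = "{(m, n). even (m + n)} :: (int \<times> int) set"
  have "infsum F UNIV = infsum F ?E + infsum F (- ?E)"
    using infsum_Un_disjoint[of F ?E "- ?E"] summable_on_subset[OF assms] by simp
  also have "infsum F ?E = (\<Sum>\<^sub>\<infinity>(u, v). F (u + v, u - v))"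
    by (rule infsum_reindex_bij_witness[of _ "\<lambda>(u, v). (u + v, u - v)" "\<lambda>(m, n). ((m + n) div 2, (m - n) div 2)"])
       (auto simp del: even_add simp: half_sum_diff)
  also have "infsum F (- ?E) = (\<Sum>\<^sub>\<infinity>(u, v). F (u + v + 1, u - v))"
    by (rule infsum_reindex_bij_witness[of _ "\<lambda>(u, v). (u + v + 1, u - v)" "\<lambda>(m, n). ((m + n - 1) div 2, (m - n - 1) div 2)"])
       (auto simp del: even_add simp: half_sum_diff)
  finally show ?thesis .
qed

lemma infsum_times_UNIV:
  fixes f g :: "int \<Rightarrow> complex"
  assumes "f summable_on UNIV" "g summable_on UNIV"
  shows "(\<lambda>(x, y). f x * g y) summable_on UNIV"
    and "(\<Sum>\<^sub>\<infinity>(x, y). f x * g y) = infsum f UNIV * infsum g UNIV"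
  using infsum_times[OF assms] by (auto simp: has_sum_iff)

lemma infsum_mult_parity_split:
  fixes f g :: "int \<Rightarrow> complex"
  assumes "f summable_on UNIV" "g summable_on UNIV"
    and "f1 summable_on UNIV" "g1 summable_on UNIV" "f2 summable_on UNIV" "g2 summable_on UNIV"
    and 1: "\<And>u v. f (u + v) * g (u - v) = f1 u * g1 v"
    and 2: "\<And>u v. f (u + v + 1) * g (u - v) = f2 u * g2 v"
  shows "infsum f UNIV * infsum g UNIV = infsum f1 UNIV * infsum g1 UNIV + infsum f2 UNIV * infsum g2 UNIV"
  using parity_split[OF infsum_times_UNIV(1)[OF assms(1,2)]] infsum_times_UNIV(2)[OF assms(1,2)]
    infsum_times_UNIV(2)[OF assms(3,4)] infsum_times_UNIV(2)[OF assms(5,6)]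
  by (simp add: 1 2)

lemma nat_power_add:
  "0 \<le> a \<Longrightarrow> 0 \<le> b \<Longrightarrow> (q::complex) ^ nat a * q ^ nat b = q ^ nat (a + b)"
  by (simp add: nat_add_distrib power_add)

lemma nat_power_mult: "((q::complex) ^ k) ^ nat a = q ^ nat (int k * a)"
  by (simp add: power_mult[symmetric] nat_mult_distrib)

lemma nat_power_cong2:
  assumes "0 \<le> a" "0 \<le> b" "0 \<le> c" "0 \<le> d" "a + b = c + d"
  shows "(q::complex) ^ nat a * q ^ nat b = q ^ nat c * q ^ nat d"
  using assms by (simp only: nat_power_add)

lemma nat_power_Suc: "0 \<le> a \<Longrightarrow> (q::complex) * q ^ nat a = q ^ nat (1 + a)"
  by (simp add: nat_add_distrib)

lemma pronic_nonneg: "0 \<le> (u::int) * (u + 1)"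
  by (auto simp: zero_le_mult_iff)

text \<open>The exponent m^2 + n^2 becomes 2u^2 + 2v^2 on equal parities and 1 + 2u(u+1) + 2v(v+1)
  on opposite ones, so both parts factor.\<close>

lemma phi_square:
  assumes q: "norm q < 1"
  shows "phi q ^ 2 = phi (q^2) ^ 2 + 4 * q * psi (q^4) ^ 2"
proof -
  have q2: "norm (q^2) < 1" "norm (q^4) < 1"
    using q by (auto intro: norm_power_less_1)
  note s = theta_series_summable
  have "phi q * phi q = phi (q^2) * phi (q^2) +
      (\<Sum>\<^sub>\<infinity>u. q * (q^4) ^ nat (u * (u + 1) div 2)) * (\<Sum>\<^sub>\<infinity>v. (q^4) ^ nat (v * (v + 1) div 2))"
    unfolding phi_def
  proof (rule infsum_mult_parity_split)
    show "q ^ nat ((u + v)^2) * q ^ nat ((u - v)^2) = (q^2) ^ nat (u^2) * (q^2) ^ nat (v^2)" for u v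
      unfolding nat_power_mult
      by (intro nat_power_cong2 mult_nonneg_nonneg zero_le_power2; simp add: algebra_simps power2_eq_square)
    show "q ^ nat ((u + v + 1)^2) * q ^ nat ((u - v)^2)
     = q * (q^4) ^ nat (u * (u + 1) div 2) * (q^4) ^ nat (v * (v + 1) div 2)" for u v
    proof -
      have "(u + v + 1)^2 + (u - v)^2 = 1 + 2 * (u * (u + 1)) + 2 * (v * (v + 1))"
        by (simp add: algebra_simps power2_eq_square)
      then have e: "(u + v + 1)^2 + (u - v)^2 = (1 + int 4 * (u * (u + 1) div 2)) + int 4 * (v * (v + 1) div 2)"
        using two_tri(1)[of u] two_tri(1)[of v] unfolding of_nat_numeral by linarith
      have n: "0 \<le> int 4 * (u * (u + 1) div 2)" "0 \<le> int 4 * (v * (v + 1) div 2)" "0 \<le> 1 + int 4 * (u * (u + 1) div 2)"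
        using tri_nonneg(1)[of u] tri_nonneg(1)[of v] by simp_all
      show ?thesis
        unfolding nat_power_mult nat_power_Suc[OF n(1)]
        by (rule nat_power_cong2[OF zero_le_power2 zero_le_power2 n(3,2) e])
    qed
  qed (intro s q q2 summable_on_cmult_right)+
  then show ?thesis
    by (simp add: psi_def infsum_cmult_right' power2_eq_square)
qed

text \<open>The reflection n to -1-n keeps n(n+1) and reverses the sign. This removes the
  opposite-parity part of phi(q) phi(-q).\<close>

lemma alt_pronic_sum: "(\<Sum>\<^sub>\<infinity>n::int. alt n * q ^ nat (n * (n + 1))) = 0"
proof -
  have "(\<Sum>\<^sub>\<infinity>n::int. alt n * q ^ nat (n * (n + 1))) = (\<Sum>\<^sub>\<infinity>n::int. - (alt n * q ^ nat (n * (n + 1))))"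
    by (rule infsum_reindex_bij_witness[of _ "\<lambda>j. - 1 - j" "\<lambda>j. - 1 - j"]) (auto simp: alt_def algebra_simps)
  then show ?thesis
    by (simp add: infsum_uminus)
qed

lemma phi_mult_phi_minus:
  assumes q: "norm q < 1"
  shows "phi q * phi (-q) = phi (- (q^2)) ^ 2"
proof -
  have q2: "norm (q^2) < 1"
    using q by (auto intro: norm_power_less_1)
  have "phi q * phi (-q) = phi (- (q^2)) * phi (- (q^2)) +
      (\<Sum>\<^sub>\<infinity>u. q * (alt u * (q^2) ^ nat (u * (u + 1)))) * (\<Sum>\<^sub>\<infinity>v. alt v * (q^2) ^ nat (v * (v + 1)))"
    unfolding phi_def power_minus_square
  proof (rule infsum_mult_parity_split)
    have a: "alt (u - v) = alt u * alt v" for u v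
      by (simp add: alt_def)
    show "q ^ nat ((u + v)^2) * (alt (u - v) * q ^ nat ((u - v)^2))
      = (alt u * (q^2) ^ nat (u^2)) * (alt v * (q^2) ^ nat (v^2))" for u v
    proof -
      have "q ^ nat ((u + v)^2) * q ^ nat ((u - v)^2) = (q^2) ^ nat (u^2) * (q^2) ^ nat (v^2)"
        unfolding nat_power_mult
      by (intro nat_power_cong2 mult_nonneg_nonneg zero_le_power2; simp add: algebra_simps power2_eq_square)
      then show ?thesis
        unfolding a by (simp add: mult_ac)
    qed
    show "q ^ nat ((u + v + 1)^2) * (alt (u - v) * q ^ nat ((u - v)^2))
     = (q * (alt u * (q^2) ^ nat (u * (u + 1)))) * (alt v * (q^2) ^ nat (v * (v + 1)))" for u v
    proof -
      have "q ^ nat ((u + v + 1)^2) * q ^ nat ((u - v)^2) = q * (q^2) ^ nat (u * (u + 1)) * (q^2) ^ nat (v * (v + 1))"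
      proof -
        have e: "(u + v + 1)^2 + (u - v)^2 = (1 + int 2 * (u * (u + 1))) + int 2 * (v * (v + 1))"
          by (simp add: algebra_simps power2_eq_square)
        have n: "0 \<le> int 2 * (u * (u + 1))" "0 \<le> int 2 * (v * (v + 1))" "0 \<le> 1 + int 2 * (u * (u + 1))"
          using pronic_nonneg[of u] pronic_nonneg[of v] by simp_all
        show ?thesis
          unfolding nat_power_mult nat_power_Suc[OF n(1)]
          by (rule nat_power_cong2[OF zero_le_power2 zero_le_power2 n(3,2) e])
      qed
      then show ?thesis
        unfolding a by (simp add: mult_ac)
    qed
  qed (intro theta_series_summable q q2 summable_on_cmult_right)+
  then show ?thesis
    by (simp add: alt_pronic_sum power2_eq_square)
qed

lemma psi_square_eq: "2 * psi (q^2) = (\<Sum>\<^sub>\<infinity>n::int. q ^ nat (n * (n + 1)))"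
proof -
  have "int 2 * (n * (n + 1) div 2) = n * (n + 1)" for n :: int
    using two_tri(1)[of n] by simp
  then show ?thesis
    unfolding psi_def nat_power_mult by simp
qed

text \<open>Two triangular numbers add up to u(u+1) + v^2 on equal parities and to (u+1)^2 + v(v+1)
  on opposite ones; each part is 2 phi(q) psi(q^2), against 4 psi(q)^2 for the whole.\<close>

lemma psi_square:
  assumes q: "norm q < 1"
  shows "psi q ^ 2 = phi q * psi (q^2)"
proof -
  let ?t = "\<lambda>n::int. n * (n + 1) div 2"
  have b: "bij_betw (\<lambda>u::int. u + 1) UNIV UNIV"
    by (rule bij_betwI[of _ _ _ "\<lambda>u. u - 1"]) auto
  have b1: "(\<lambda>u::int. q ^ nat ((u + 1)^2)) summable_on UNIV"
    using summable_on_reindex_bij_betw[OF b, of "\<lambda>u. q ^ nat (u^2)"] theta_series_summable(1)[OF q] by simp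
  have b2: "(\<Sum>\<^sub>\<infinity>u::int. q ^ nat ((u + 1)^2)) = phi q"
    using infsum_reindex_bij_betw[OF b, of "\<lambda>u. q ^ nat (u^2)"] by (simp add: phi_def)
  have "(\<Sum>\<^sub>\<infinity>n. q ^ nat (?t n)) * (\<Sum>\<^sub>\<infinity>n. q ^ nat (?t n)) =
    (\<Sum>\<^sub>\<infinity>n::int. q ^ nat (n * (n + 1))) * (\<Sum>\<^sub>\<infinity>n::int. q ^ nat (n^2)) +
    (\<Sum>\<^sub>\<infinity>n::int. q ^ nat ((n + 1)^2)) * (\<Sum>\<^sub>\<infinity>n::int. q ^ nat (n * (n + 1)))"
  proof (rule infsum_mult_parity_split)
    fix u v
    have "?t (u + v) + ?t (u - v) = u * (u + 1) + v^2"
      using two_tri(1)[of "u + v"] two_tri(1)[of "u - v"] by (simp add: algebra_simps power2_eq_square)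
    then show "q ^ nat (?t (u + v)) * q ^ nat (?t (u - v)) = q ^ nat (u * (u + 1)) * q ^ nat (v^2)"
      by (intro nat_power_cong2 tri_nonneg pronic_nonneg zero_le_power2)
    have "?t (u + v + 1) + ?t (u - v) = (u + 1)^2 + v * (v + 1)"
      using two_tri(1)[of "u + v + 1"] two_tri(1)[of "u - v"] by (simp add: algebra_simps power2_eq_square)
    then show "q ^ nat (?t (u + v + 1)) * q ^ nat (?t (u - v)) = q ^ nat ((u + 1)^2) * q ^ nat (v * (v + 1))"
      by (intro nat_power_cong2 tri_nonneg pronic_nonneg zero_le_power2)
  qed (intro theta_series_summable q b1)+
  then have "(2 * psi q) * (2 * psi q) = 2 * psi (q^2) * phi q + phi q * (2 * psi (q^2))"
    unfolding b2 psi_square_eq by (simp add: psi_def phi_def)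
  then show ?thesis by (simp add: power2_eq_square)
qed

text \<open>By \<open>phi_square\<close>, phi(q)^2 and phi(-q)^2 are the sum and the difference of
  the same two terms; the difference of their squares is four times the product of these terms,
  which \<open>psi_square\<close> at q^2 evaluates.\<close>

lemma jacobi_quartic:
  assumes q: "norm q < 1"
  shows "phi q ^ 4 = phi (-q) ^ 4 + 16 * q * psi (q^2) ^ 4"
proof -
  have q': "norm (-q) < 1" "norm (q^2) < 1"
    using q by (auto intro: norm_power_less_1)
  have "(phi q)^2 * (phi q)^2 - (phi (-q))^2 * (phi (-q))^2 = 16 * q * (phi (q^2) * psi (q^4))^2"
    unfolding phi_square[OF q] phi_square[OF q'(1)] by (simp add: algebra_simps power2_eq_square)
  also have "phi (q^2) * psi (q^4) = psi (q^2) ^ 2"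
    using psi_square[OF q'(2)] by simp
  finally show ?thesis
    by (simp add: algebra_simps flip: power_add)
qed

text \<open>Enumerated by \<open>int_decode\<close>, the series is a limit of polynomials, uniform
  on smaller closed discs, so holomorphy and derivatives pass to it. The operator q d/dq multiplies
  q^e by e without lowering the exponent, which keeps truncated subtraction out of the
  result.\<close>

lemma theta_holomorphic_deriv:
  fixes e :: "int \<Rightarrow> nat"
  assumes e: "\<And>n. nat \<bar>n\<bar> \<le> e n + 1" and w: "\<And>n. real (e n) \<le> C * (1 + \<bar>real_of_int n\<bar>)^2"
  defines "f \<equiv> (\<lambda>q::complex. \<Sum>\<^sub>\<infinity>n. q ^ e n)"
  shows "f holomorphic_on ball 0 1"
    and "norm q < 1 \<Longrightarrow> q * deriv f q = (\<Sum>\<^sub>\<infinity>n. of_nat (e n) * q ^ e n)"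
proof -
  define p where "p n q = (\<Sum>k<n. (q::complex) ^ e (int_decode k))" for n q
  have sumq: "(\<lambda>n. q ^ e n) summable_on UNIV" if "norm q < 1" for q :: complex
    using theta_summable[OF that e weight_bounds(1)] by simp
  have lim: "uniform_limit (cball 0 r) p f sequentially" if r: "0 \<le> r" "r < 1" for r
  proof -
    have "uniform_limit (cball 0 r) (\<lambda>n q. \<Sum>k<n. (q::complex) ^ e (int_decode k)) (\<lambda>q. \<Sum>k. q ^ e (int_decode k)) sequentially"
    proof (rule Weierstrass_m_test)
      show "norm (q ^ e (int_decode k)) \<le> r ^ e (int_decode k)" if "q \<in> cball 0 r" for k and q :: complex
        using that by (simp add: norm_power power_mono)
      show "summable (\<lambda>k. r ^ e (int_decode k))"
        using sums_int_decode(1)[OF sumq[of "of_real r"]] r by (simp add: norm_power)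
    qed
    moreover have "(\<Sum>k. q ^ e (int_decode k)) = f q" if "q \<in> cball 0 r" for q
      using sums_int_decode(2)[OF sumq[of q]] that r by (simp add: f_def sums_iff)
    moreover have "uniform_limit (cball 0 r) p f sequentially \<longleftrightarrow>
      uniform_limit (cball 0 r) (\<lambda>n q. \<Sum>k<n. (q::complex) ^ e (int_decode k)) (\<lambda>q. \<Sum>k. q ^ e (int_decode k)) sequentially"
      by (rule uniform_limit_cong') (simp_all add: p_def calculation(2))
    ultimately show ?thesis by blast
  qed
  have hol: "p n holomorphic_on A" for n A
    unfolding p_def by (intro holomorphic_intros)
  show "f holomorphic_on ball 0 1"
  proof (rule holomorphic_uniform_sequence)
    show "p n holomorphic_on ball 0 1" for n by (rule hol)
    fix x :: complex assume "x \<in> ball 0 1"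
    define r where "r = (1 + norm x) / 2"
    define d where "d = (1 - norm x) / 2"
    have "cball x d \<subseteq> cball 0 r" "r < 1" "0 \<le> r" "d > 0"
      using \<open>x \<in> ball 0 1\<close> by (auto simp: r_def d_def cball_subset_cball_iff dist_norm field_simps)
    moreover have "cball x d \<subseteq> ball 0 1"
      using \<open>cball x d \<subseteq> cball 0 r\<close> \<open>r < 1\<close> by (auto dest!: subsetD)
    ultimately show "\<exists>d>0. cball x d \<subseteq> ball 0 1 \<and> uniform_limit (cball x d) p f sequentially"
      using lim uniform_limit_on_subset by blast
  qed auto
  assume q: "norm q < 1"
  define r where "r = (1 + norm q) / 2"
  have r: "norm q < r" "r < 1" "0 \<le> r"
    using q by (auto simp: r_def field_simps intro: add_nonneg_nonneg)
  have "uniform_limit (ball 0 r) p f sequentially"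
    using lim[OF r(3,2)] by (rule uniform_limit_on_subset) auto
  then have "(\<lambda>n. deriv (p n) q) \<longlonglongrightarrow> deriv f q"
    by (rule deriv_complex_uniform_limit) (use r hol in \<open>auto intro!: always_eventually\<close>)
  then have "(\<lambda>n. q * deriv (p n) q) \<longlonglongrightarrow> q * deriv f q"
    by (intro tendsto_intros)
  moreover have "q * deriv (p n) q = (\<Sum>k<n. of_nat (e (int_decode k)) * q ^ e (int_decode k))" for n
  proof -
    have "(p n has_field_derivative (\<Sum>k<n. of_nat (e (int_decode k)) * q ^ (e (int_decode k) - 1))) (at q)"
      unfolding p_def by (auto intro!: derivative_eq_intros simp: mult.commute)
    then have "deriv (p n) q = (\<Sum>k<n. of_nat (e (int_decode k)) * q ^ (e (int_decode k) - 1))"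
      by (rule DERIV_imp_deriv)
    moreover have "q * (of_nat j * q ^ (j - 1)) = of_nat j * q ^ j" for j
      by (cases j) auto
    ultimately show ?thesis
      by (simp only: sum_distrib_left)
  qed
  moreover have "norm (of_nat (e n) :: complex) \<le> C * (1 + \<bar>real_of_int n\<bar>)^2" for n
    using w by simp
  from sums_int_decode(2)[OF theta_summable[OF q e this]]
  have "(\<lambda>n. \<Sum>k<n. of_nat (e (int_decode k)) * q ^ e (int_decode k)) \<longlonglongrightarrow> (\<Sum>\<^sub>\<infinity>n. of_nat (e n) * q ^ e n)"
    by (simp add: sums_def)
  ultimately show "q * deriv f q = (\<Sum>\<^sub>\<infinity>n. of_nat (e n) * q ^ e n)"
    using LIMSEQ_unique by simp
qed

section \<open>Derivatives of theta functions\<close>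

lemma psi_sq_eq: "psi (q^2) = (\<Sum>\<^sub>\<infinity>n::int. q ^ nat (n * (n + 1))) / 2"
  using psi_square_eq[of q] by (simp add: field_simps)

lemma square_weight_bounds:
  "real (nat (n^2)) \<le> 4 * (1 + \<bar>real_of_int n\<bar>)^2"
  "real (nat (n * (n + 1))) \<le> 4 * (1 + \<bar>real_of_int n\<bar>)^2"
proof -
  define x where "x = \<bar>real_of_int n\<bar>"
  have x: "0 \<le> x" "0 \<le> x * x" "real_of_int n \<le> x" "real_of_int n * real_of_int n = x * x"
    by (auto simp: x_def)
  show "real (nat (n^2)) \<le> 4 * (1 + \<bar>real_of_int n\<bar>)^2"
    using x unfolding x_def[symmetric] by (simp add: power2_eq_square algebra_simps)
  show "real (nat (n * (n + 1))) \<le> 4 * (1 + \<bar>real_of_int n\<bar>)^2"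
  proof -
    have "real (nat (n * (n + 1))) = real_of_int n * real_of_int n + real_of_int n"
      using pronic_nonneg[of n] by (simp add: algebra_simps)
    also have "\<dots> \<le> 4 + 8 * x + 4 * (x * x)"
      using x by linarith
    also have "\<dots> = 4 * (1 + x)^2"
      by (simp add: power2_eq_square algebra_simps)
    finally show ?thesis unfolding x_def .
  qed
qed

lemma phi_holomorphic: "phi holomorphic_on ball 0 1"
  and phi_deriv: "norm q < 1 \<Longrightarrow> q * deriv phi q = (\<Sum>\<^sub>\<infinity>n::int. of_nat (nat (n^2)) * q ^ nat (n^2))"
  using theta_holomorphic_deriv[OF nat_exponent_bounds(1) square_weight_bounds(1)]
  unfolding phi_def[abs_def] by blast+

lemma psi_sq_holomorphic: "(\<lambda>q. psi (q^2)) holomorphic_on ball 0 1"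
  and psi_sq_deriv: "norm q < 1 \<Longrightarrow> 2 * (q * deriv (\<lambda>q. psi (q^2)) q)
      = (\<Sum>\<^sub>\<infinity>n::int. of_nat (nat (n * (n + 1))) * q ^ nat (n * (n + 1)))"
proof -
  let ?f = "\<lambda>q::complex. \<Sum>\<^sub>\<infinity>n::int. q ^ nat (n * (n + 1))"
  note * = theta_holomorphic_deriv[OF nat_exponent_bounds(4) square_weight_bounds(2)]
  show "(\<lambda>q. psi (q^2)) holomorphic_on ball 0 1"
    unfolding psi_sq_eq by (intro holomorphic_intros *) auto
  assume q: "norm q < 1"
  have "(?f has_field_derivative deriv ?f q) (at q)"
    by (rule holomorphic_derivI[OF *(1)]) (use q in auto)
  then have "((\<lambda>q. psi (q^2)) has_field_derivative deriv ?f q / 2) (at q)"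
    unfolding psi_sq_eq by (rule DERIV_cdivide)
  then show "2 * (q * deriv (\<lambda>q. psi (q^2)) q) = (\<Sum>\<^sub>\<infinity>n::int. of_nat (nat (n * (n + 1))) * q ^ nat (n * (n + 1)))"
    using *(2)[OF q] by (simp add: DERIV_imp_deriv)
qed

text \<open>Up to a constant and a power of q, the left side is the Wronskian of phi(q) and q^(1/4)
  psi(q^2). Split the square of the series with terms g(s) = (2s+1) q^(s(s+1)/2) by parity into E +
  O'. Reflection makes the series vanish, so O' = -E; with alternating signs it is Jacobi's series,
  whose square is E - O' = 2E. Finally (2u+2v+1)(2u-2v+1) = 1 + 4u(u+1) - 4v^2 expresses E by
  derivatives of the two theta series.\<close>

lemma theta_quotient_deriv_aux:
  assumes q: "norm q < 1" "q \<noteq> 0"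
  shows "phi q * (psi (q^2) + 4 * (q * deriv (\<lambda>q. psi (q^2)) q)) - 4 * (q * deriv phi q) * psi (q^2)
    = euler_fun q ^ 6"
proof -
  define g where "g s = of_int (2 * s + 1) * q ^ nat (s * (s + 1) div 2)" for s
  define g' where "g' s = alt s * g s" for s
  have sg': "g' summable_on UNIV"
    using summable_on_add[OF summable_on_cmult_right[OF theta_series_summable(8)[OF q(1)], of 2] theta_series_summable(7)[OF q(1)]]
    by (simp add: g_def[abs_def] g'_def[abs_def] algebra_simps)
  have sg: "g summable_on UNIV"
  proof -
    have "(\<lambda>s. norm (g' s)) = (\<lambda>s. norm (g s))"
      by (simp add: g'_def norm_mult)
    then show ?thesis
      using sg' unfolding summable_on_iff_abs_summable_on_complex[of g] summable_on_iff_abs_summable_on_complex[of g'] by simp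
  qed
  have "infsum g UNIV = (\<Sum>\<^sub>\<infinity>s. - g s)"
    by (rule infsum_reindex_bij_witness[of _ "\<lambda>j. - 1 - j" "\<lambda>j. - 1 - j"]) (auto simp: g_def algebra_simps)
  then have g0: "infsum g UNIV = 0"
    by (simp add: infsum_uminus)
  have g'0: "infsum g' UNIV = 2 * euler_fun q ^ 3"
    using euler_cubed[OF q] by (simp add: g'_def[abs_def] g_def[abs_def] mult_ac)
  define E where "E = (\<Sum>\<^sub>\<infinity>(u, v). g (u + v) * g (u - v))"
  define O' where "O' = (\<Sum>\<^sub>\<infinity>(u, v). g (u + v + 1) * g (u - v))"
  have "0 = E + O'"
    using parity_split[OF infsum_times_UNIV(1)[OF sg sg]] infsum_times_UNIV(2)[OF sg sg] g0
    by (simp add: E_def O'_def)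
  moreover have "(2 * euler_fun q ^ 3) * (2 * euler_fun q ^ 3) = E - O'"
  proof -
    have "(\<Sum>\<^sub>\<infinity>(u, v). g' (u + v) * g' (u - v)) = E"
      unfolding E_def by (intro infsum_cong) (auto simp: g'_def alt_def)
    moreover have "(\<Sum>\<^sub>\<infinity>(u, v). g' (u + v + 1) * g' (u - v)) = (\<Sum>\<^sub>\<infinity>x. - (case x of (u, v) \<Rightarrow> g (u + v + 1) * g (u - v)))"
      by (intro infsum_cong) (auto simp: g'_def alt_def)
    ultimately show ?thesis
      using parity_split[OF infsum_times_UNIV(1)[OF sg' sg']] infsum_times_UNIV(2)[OF sg' sg'] g'0
      by (simp add: O'_def infsum_uminus)
  qed
  ultimately have E: "E = 2 * euler_fun q ^ 6"
    by (simp add: eval_nat_numeral algebra_simps eq_neg_iff_add_eq_0[symmetric])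
  define T P where "T n = q ^ nat (n * (n + 1))" and "P n = q ^ nat (n^2)" for n :: int
  define T' P' where "T' n = of_nat (nat (n * (n + 1))) * T n" and "P' n = of_nat (nat (n^2)) * P n" for n
  have sT: "T summable_on UNIV" and sP: "P summable_on UNIV"
    unfolding T_def[abs_def] P_def[abs_def] by (intro theta_series_summable q)+
  have sT': "T' summable_on UNIV" and sP': "P' summable_on UNIV"
    unfolding T'_def[abs_def] P'_def[abs_def] T_def P_def
    by (rule theta_summable[OF q(1)]; (rule nat_exponent_bounds | simp only: norm_of_nat, rule square_weight_bounds))+
  have 1: "(\<lambda>n. T n + 4 * T' n) summable_on UNIV" "(\<lambda>n. -4 * P' n) summable_on UNIV"
    by (intro summable_on_add summable_on_cmult_right sT sT' sP')+
  have "g (u + v) * g (u - v) = (T u + 4 * T' u) * P v + T u * (-4 * P' v)" for u v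
  proof -
    have "(u + v) * (u + v + 1) div 2 + (u - v) * (u - v + 1) div 2 = u * (u + 1) + v^2"
      using two_tri(1)[of "u + v"] two_tri(1)[of "u - v"] by (simp add: algebra_simps power2_eq_square)
    then have "q ^ nat ((u + v) * (u + v + 1) div 2) * q ^ nat ((u - v) * (u - v + 1) div 2) = T u * P v"
      unfolding T_def P_def by (intro nat_power_cong2 tri_nonneg pronic_nonneg zero_le_power2)
    moreover have "of_int (2 * (u + v) + 1) * of_int (2 * (u - v) + 1) =
       (1 + 4 * of_nat (nat (u * (u + 1))) - 4 * of_nat (nat (v^2)) :: complex)"
      using pronic_nonneg[of u] by (simp add: algebra_simps power2_eq_square)
    ultimately have "g (u + v) * g (u - v) = (1 + 4 * of_nat (nat (u * (u + 1))) - 4 * of_nat (nat (v^2))) * (T u * P v)"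
      unfolding g_def by (metis (no_types, lifting) mult.assoc mult.left_commute)
    then show ?thesis
      by (simp add: T'_def P'_def algebra_simps)
  qed
  then have "E = (\<Sum>\<^sub>\<infinity>x. (case x of (u, v) \<Rightarrow> (T u + 4 * T' u) * P v) + (case x of (u, v) \<Rightarrow> T u * (-4 * P' v)))"
    unfolding E_def by (intro infsum_cong) auto
  also have "\<dots> = (\<Sum>\<^sub>\<infinity>(u, v). (T u + 4 * T' u) * P v) + (\<Sum>\<^sub>\<infinity>(u, v). T u * (-4 * P' v))"
    by (intro infsum_add infsum_times_UNIV(1) 1 sT sP)
  also have "\<dots> = (infsum T UNIV + 4 * infsum T' UNIV) * infsum P UNIV + infsum T UNIV * (-4 * infsum P' UNIV)"
    unfolding infsum_times_UNIV(2)[OF 1(1) sP] infsum_times_UNIV(2)[OF sT 1(2)]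
    by (simp add: infsum_add sT sT' summable_on_cmult_right infsum_cmult_right' infsum_uminus)
  finally have fin: "2 * euler_fun q ^ 6 = (infsum T UNIV + 4 * infsum T' UNIV) * infsum P UNIV + infsum T UNIV * (-4 * infsum P' UNIV)"
    unfolding E .
  have "infsum T UNIV = 2 * psi (q^2)" "infsum P UNIV = phi q"
    "infsum T' UNIV = 2 * (q * deriv (\<lambda>q. psi (q^2)) q)" "infsum P' UNIV = q * deriv phi q"
    using phi_deriv[OF q(1)] psi_sq_deriv[OF q(1)] psi_square_eq[of q]
    by (simp_all add: T_def[abs_def] P_def[abs_def] T'_def[abs_def] P'_def[abs_def] phi_def)
  from fin[unfolded this] show ?thesis
    by algebra
qed

text \<open>The product formulas turn the Euler product into theta functions. Divided by phi(q)
  psi(q^2), the result says that q psi(q^2)^4 / phi(q)^4 has logarithmic derivative phi(-q)^4 for q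
  d/dq.\<close>

lemma theta_quotient_deriv:
  assumes q: "norm q < 1" "q \<noteq> 0"
  shows "phi q * (psi (q^2) + 4 * (q * deriv (\<lambda>q. psi (q^2)) q)) - 4 * (q * deriv phi q) * psi (q^2)
    = phi (-q) ^ 4 * phi q * psi (q^2)"
proof -
  have q2: "norm (q^2) < 1"
    using q by (auto intro: norm_power_less_1)
  note nz = euler_nonzero[OF q(1)] euler_nonzero[OF q2]
  have 1: "phi (-q) = euler_fun q ^ 2 / euler_fun (q^2)" "psi q = euler_fun (q^2) ^ 2 / euler_fun q"
    using phi_minus_eq[OF q] psi_eq[OF q] nz by (simp_all add: field_simps)
  have "euler_fun q ^ 6 = phi (-q) ^ 4 * psi q ^ 2"
    unfolding 1 using nz by (simp add: field_simps eval_nat_numeral)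
  then show ?thesis
    using theta_quotient_deriv_aux[OF q] psi_square[OF q(1)] by (simp add: mult.assoc)
qed

section \<open>The modular equation of degree 7\<close>

definition qform :: "int \<times> int \<Rightarrow> int" where
  "qform = (\<lambda>(x, y). x^2 + x * y + 2 * y^2)"

definition lattice_theta :: "(int \<times> int) set \<Rightarrow> complex \<Rightarrow> complex" where
  "lattice_theta S q = (\<Sum>\<^sub>\<infinity>p\<in>S. q ^ nat (qform p))"

lemma two_qform: "2 * qform (x, y) = (x + y)^2 + x^2 + 3 * y^2"
  by (simp add: qform_def power2_eq_square algebra_simps)

lemma qform_nonneg: "0 \<le> qform p"
proof (cases p)
  case (Pair x y)
  have "0 \<le> (x + y)^2 + x^2 + 3 * y^2" by simp
  then show ?thesis
    unfolding Pair using two_qform[of x y] by linarith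
qed

lemma lattice_theta_summable:
  fixes q :: complex
  assumes q: "norm q < 1"
  shows "(\<lambda>p. q ^ nat (qform p)) summable_on S"
proof -
  \<comment> \<open>The square root compensates the factor 2 in |x| + |y| being at most 2
    \<open>qform (x, y)\<close>.\<close>
  define r where "r = sqrt (norm q)"
  have r: "0 \<le> r" "r < 1" "r^2 = norm q"
    using q by (auto simp: r_def)
  have "(\<lambda>n::int. 1 * complex_of_real r ^ nat \<bar>n\<bar>) summable_on UNIV"
    by (rule theta_summable[OF _ _ weight_bounds(1)]) (use r in auto)
  then have s: "(\<lambda>n::int. complex_of_real r ^ nat \<bar>n\<bar>) summable_on UNIV" by simp
  have "(\<lambda>p. norm (q ^ nat (qform p))) summable_on UNIV"
  proof (rule Infinite_Sum.abs_summable_on_comparison_test)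
    show "(\<lambda>p. norm (case p of (x::int, y::int) \<Rightarrow> complex_of_real r ^ nat \<bar>x\<bar> * complex_of_real r ^ nat \<bar>y\<bar>)) summable_on UNIV"
      using infsum_times_UNIV(1)[OF s s] summable_on_iff_abs_summable_on_complex by blast
    fix p :: "int \<times> int"
    obtain x y where p: "p = (x, y)" by force
    have "\<bar>x\<bar> + \<bar>y\<bar> \<le> 2 * qform (x, y)"
      using abs_le_square[of x] abs_le_square[of y] two_qform[of x y] zero_le_power2[of "x + y"] zero_le_power2[of y]
      by linarith
    then have "nat \<bar>x\<bar> + nat \<bar>y\<bar> \<le> 2 * nat (qform (x, y))"
      using qform_nonneg[of "(x, y)"] by linarith
    then have "r ^ (2 * nat (qform (x, y))) \<le> r ^ (nat \<bar>x\<bar> + nat \<bar>y\<bar>)"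
      using r by (intro power_decreasing) auto
    then show "norm (q ^ nat (qform p)) \<le> norm (case p of (x, y) \<Rightarrow> complex_of_real r ^ nat \<bar>x\<bar> * complex_of_real r ^ nat \<bar>y\<bar>)"
      using r by (simp add: p norm_power norm_mult power_mult power_add)
  qed
  then have "(\<lambda>p. q ^ nat (qform p)) summable_on UNIV"
    by (rule abs_summable_summable)
  then show ?thesis
    by (rule summable_on_subset) auto
qed

lemma lattice_theta_Un:
  assumes "norm q < 1" "A \<inter> B = {}"
  shows "lattice_theta (A \<union> B) q = lattice_theta A q + lattice_theta B q"
  unfolding lattice_theta_def by (intro infsum_Un_disjoint lattice_theta_summable assms)

text \<open>Writing \<open>(x, y)\<close> for \<open>x + y\<omega>\<close> with \<open>\<omega> = (1 + \<surd>-7) / 2\<close>, the form is the norm of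
  \<open>\<int>[\<omega>]\<close>; this is multiplication by \<open>\<omega>\<close>, an element of norm 2.\<close>
lemma lattice_theta_double:
  "lattice_theta {(x, y). even x} q = lattice_theta UNIV (q^2)"
  unfolding lattice_theta_def nat_power_mult
  by (rule infsum_reindex_bij_witness[of _ "\<lambda>(x, y). (- 2 * y, x + y)" "\<lambda>(x, y). (y + x div 2, - (x div 2))"])
     (auto simp: qform_def power2_eq_square algebra_simps elim!: evenE)

text \<open>Multiplication by 2 scales the norm by 4, and the preceding lemma at q^2 undoes one of
  the two doublings.\<close>

lemma lattice_theta_quadruple:
  "lattice_theta {(x, y). even x \<and> even y} q = lattice_theta {(x, y). even x} (q^2)"
proof -
  have "lattice_theta {(x, y). even x \<and> even y} q = lattice_theta UNIV ((q^2)^2)"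
    unfolding lattice_theta_def nat_power_mult
    by (rule infsum_reindex_bij_witness[of _ "\<lambda>(x, y). (2 * x, 2 * y)" "\<lambda>(x, y). (x div 2, y div 2)"])
       (auto simp: qform_def power2_eq_square algebra_simps elim!: evenE)
  then show ?thesis
    by (simp add: lattice_theta_double)
qed

text \<open>Complex conjugation, which maps x + y omega to (x + y) - y omega and exchanges the two
  prime ideals above 2.\<close>

lemma lattice_theta_conj:
  "lattice_theta {(x, y). odd x \<and> odd y} q = lattice_theta {(x, y). even x \<and> odd y} q"
  unfolding lattice_theta_def
  by (rule infsum_reindex_bij_witness[of _ "\<lambda>(x, y). (x + y, - y)" "\<lambda>(x, y). (x + y, - y)"])
     (auto simp: qform_def power2_eq_square algebra_simps)

text \<open>Write ee, eo, oe, oo for the sums over the parity classes of (x, y), primed at q^2.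
  Doubling gives ee + eo = ee' + eo' + oe' + oo', quadrupling gives ee = ee' + eo', conjugation
  gives oo' = eo'. Hence eo = oe' + eo', and subtraction gives the claim.\<close>

lemma lattice_theta_relation:
  assumes q: "norm q < 1"
  shows "lattice_theta {(x, y). even x \<and> even y} q - lattice_theta {(x, y). even x \<and> odd y} q
    = lattice_theta {(x, y). even x \<and> even y} (q^2) - lattice_theta {(x, y). odd x \<and> even y} (q^2)"
proof -
  have q2: "norm (q^2) < 1"
    using q by (auto intro: norm_power_less_1)
  have ev: "lattice_theta {(x, y). even x} q
      = lattice_theta {(x, y). even x \<and> even y} q + lattice_theta {(x, y). even x \<and> odd y} q"
    if "norm q < 1" for q
    by (subst lattice_theta_Un[OF that, symmetric]) (auto intro!: arg_cong2[where f = lattice_theta])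
  have "lattice_theta UNIV (q^2) = lattice_theta {(x, y). even x} (q^2)
     + (lattice_theta {(x, y). odd x \<and> even y} (q^2) + lattice_theta {(x, y). odd x \<and> odd y} (q^2))"
    by (subst lattice_theta_Un[OF q2, symmetric], force)+ (auto intro!: arg_cong2[where f = lattice_theta])
  then show ?thesis
    using ev[OF q] ev[OF q2] lattice_theta_quadruple[of q] lattice_theta_double[of q] lattice_theta_conj[of "q^2"]
    by (simp add: algebra_simps)
qed

text \<open>m^2 + 7n^2 is the norm of m + n sqrt(-7) = (m - n) + 2n omega, so exactly the points
  with even y occur; the sign (-1)^(m+n) is the parity of x = m - n.\<close>

lemma phi_mult_phi_7:
  assumes q: "norm q < 1"
  shows "phi q * phi (q^7) = lattice_theta {(x, y). even x \<and> even y} q + lattice_theta {(x, y). odd x \<and> even y} q"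
    and "phi (-q) * phi (- (q^7)) = lattice_theta {(x, y). even x \<and> even y} q - lattice_theta {(x, y). odd x \<and> even y} q"
proof -
  have q7: "norm (q^7) < 1"
    using q by (auto intro: norm_power_less_1)
  have e: "q ^ nat (m^2) * (q^7) ^ nat (n^2) = q ^ nat (qform (m - n, 2 * n))" for m n
  proof -
    have "m^2 + int 7 * n^2 = qform (m - n, 2 * n)"
      by (simp add: qform_def power2_eq_square algebra_simps)
    then show ?thesis
      unfolding nat_power_mult by (subst nat_power_add) auto
  qed
  have split: "(\<Sum>\<^sub>\<infinity>p\<in>{(x, y). even y}. w p * q ^ nat (qform p)) =
     (\<Sum>\<^sub>\<infinity>p\<in>{(x, y). even x \<and> even y}. w p * q ^ nat (qform p)) + (\<Sum>\<^sub>\<infinity>p\<in>{(x, y). odd x \<and> even y}. w p * q ^ nat (qform p))"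
    if "\<And>p. norm (w p) = 1" for w
  proof -
    have "(\<lambda>p. w p * q ^ nat (qform p)) summable_on S" for S
      using lattice_theta_summable[OF q, of S] that
      unfolding summable_on_iff_abs_summable_on_complex by (simp add: norm_mult)
    then show ?thesis
      by (subst infsum_Un_disjoint[symmetric]) (auto intro!: arg_cong2[where f = infsum])
  qed
  have re: "(\<Sum>\<^sub>\<infinity>(m, n). h (m - n) * (q ^ nat (m^2) * (q^7) ^ nat (n^2))) =
     (\<Sum>\<^sub>\<infinity>(x, y)\<in>{(x, y). even y}. h x * q ^ nat (qform (x, y)))" for h
    unfolding e
    by (rule infsum_reindex_bij_witness[of _ "\<lambda>(x, y). (x + y div 2, y div 2)" "\<lambda>(m, n). (m - n, 2 * n)"])
      auto
  show "phi q * phi (q^7) = lattice_theta {(x, y). even x \<and> even y} q + lattice_theta {(x, y). odd x \<and> even y} q"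
    using infsum_times_UNIV(2)[OF theta_series_summable(1)[OF q] theta_series_summable(1)[OF q7]] re[of "\<lambda>_. 1"] split[of "\<lambda>_. 1"]
    by (simp add: phi_def lattice_theta_def case_prod_unfold)
  have a: "(alt m * q ^ nat (m^2)) * (alt n * (q^7) ^ nat (n^2)) = alt (m - n) * (q ^ nat (m^2) * (q^7) ^ nat (n^2))" for m n
    by (simp add: alt_def)
  have "phi (-q) * phi (- (q^7)) = (\<Sum>\<^sub>\<infinity>(m, n). alt (m - n) * (q ^ nat (m^2) * (q^7) ^ nat (n^2)))"
    using infsum_times_UNIV(2)[OF theta_series_summable(5)[OF q] theta_series_summable(5)[OF q7]]
    unfolding phi_def power_minus_square a by simp
  also have "\<dots> = (\<Sum>\<^sub>\<infinity>p\<in>{(x, y). even x \<and> even y}. alt (fst p) * q ^ nat (qform p)) + (\<Sum>\<^sub>\<infinity>p\<in>{(x, y). odd x \<and> even y}. alt (fst p) * q ^ nat (qform p))"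
    using re[of alt] split[of "\<lambda>p. alt (fst p)"] by (simp add: case_prod_unfold)
  also have "(\<Sum>\<^sub>\<infinity>p\<in>{(x, y). even x \<and> even y}. alt (fst p) * q ^ nat (qform p)) = lattice_theta {(x, y). even x \<and> even y} q"
    unfolding lattice_theta_def by (intro infsum_cong) (auto simp: alt_def)
  also have "(\<Sum>\<^sub>\<infinity>p\<in>{(x, y). odd x \<and> even y}. alt (fst p) * q ^ nat (qform p)) = (\<Sum>\<^sub>\<infinity>p\<in>{(x, y). odd x \<and> even y}. - (q ^ nat (qform p)))"
    by (intro infsum_cong) (auto simp: alt_def)
  finally show "phi (-q) * phi (- (q^7)) = lattice_theta {(x, y). even x \<and> even y} q - lattice_theta {(x, y). odd x \<and> even y} q"
    by (simp add: infsum_uminus lattice_theta_def)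
qed

text \<open>The element ((2m+1) + (2n+1) sqrt(-7)) / 2 has norm 2 (1 + m(m+1)/2 + 7n(n+1)/2). For
  even m + n it is divisible by omega, and the quotient has the required norm. Pairs with odd m + n
  contribute the same by n to -1-n.\<close>

lemma psi_mult_psi_7:
  assumes q: "norm q < 1"
  shows "2 * q * psi q * psi (q^7) = lattice_theta {(x, y). odd (x + y)} q"
proof -
  have q7: "norm (q^7) < 1"
    using q by (auto intro: norm_power_less_1)
  define F where "F = (\<lambda>(m::int, n::int). q ^ nat (m * (m + 1) div 2) * (q^7) ^ nat (n * (n + 1) div 2))"
  note s = infsum_times_UNIV[OF theta_series_summable(2)[OF q] theta_series_summable(2)[OF q7], folded F_def]
  let ?E = "{(m, n). even (m + n)} :: (int \<times> int) set"
  have "4 * psi q * psi (q^7) = infsum F UNIV"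
    by (simp add: s(2) psi_def)
  also have "\<dots> = infsum F ?E + infsum F (- ?E)"
    using infsum_Un_disjoint[of F ?E "- ?E"] summable_on_subset[OF s(1)] by simp
  also have "infsum F (- ?E) = infsum F ?E"
    by (rule infsum_reindex_bij_witness[of _ "\<lambda>(m, n). (m, - 1 - n)" "\<lambda>(m, n). (m, - 1 - n)"])
       (auto simp: F_def algebra_simps)
  finally have "2 * psi q * psi (q^7) = infsum F ?E"
    by (simp add: mult.assoc)
  moreover have "q * infsum F ?E = lattice_theta {(x, y). odd (x + y)} q"
    unfolding infsum_cmult_right'[symmetric] lattice_theta_def
  \<comment> \<open>The second map is that division by omega; its image satisfies x + y = 2n + 1,
    from which n and then m are recovered.\<close>
  proof (rule infsum_reindex_bij_witness[of _ "\<lambda>(x, y). ((x + y - 1) div 2 - 2 * y, (x + y - 1) div 2)"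
        "\<lambda>(m, n). (2 * n + 1 - (n - m) div 2, (n - m) div 2)"])
    fix p assume "p \<in> ?E"
    then obtain m n where p: "p = (m, n)" "even (m + n)" by auto
    then obtain k where k: "n - m = 2 * k"
      by (metis even_add even_diff evenE)
    have "2 * qform (2 * n + 1 - k, k) = 2 + m * (m + 1) + 7 * (n * (n + 1))"
      using k by (simp add: qform_def power2_eq_square eq_diff_eq[symmetric]) (simp add: algebra_simps)
    then have "qform (2 * n + 1 - k, k) = (1 + m * (m + 1) div 2) + int 7 * (n * (n + 1) div 2)"
      using two_tri(1)[of m] two_tri(1)[of n] unfolding of_nat_numeral by linarith
    moreover have "q * F (m, n) = q ^ nat ((1 + m * (m + 1) div 2) + int 7 * (n * (n + 1) div 2))"
      unfolding F_def nat_power_mult using tri_nonneg(1)[of m] tri_nonneg(1)[of n]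
      by (simp add: nat_power_Suc nat_power_add mult.assoc[symmetric] add.assoc)
    ultimately show "q ^ nat (qform (case p of (m, n) \<Rightarrow> (2 * n + 1 - (n - m) div 2, (n - m) div 2))) = q * F p"
      by (simp add: p k)
  qed (auto elim!: evenE oddE simp: algebra_simps; presburger)+
  ultimately show ?thesis
    by (simp add: mult_ac)
qed

text \<open>In the notation by parity classes the three products are ee + oe, ee' - oe' = ee - eo
  and oe + eo. Divided by phi(q) phi(q^7), this is Guetzlaff's form of the degree 7
  equation.\<close>

theorem modular_equation_7:
  assumes q: "norm q < 1"
  shows "phi q * phi (q^7) = phi (- (q^2)) * phi (- (q^14)) + 2 * q * psi q * psi (q^7)"
proof -
  have q2: "norm (q^2) < 1"
    using q by (auto intro: norm_power_less_1)
  have "lattice_theta {(x, y). odd (x + y)} q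
     = lattice_theta {(x, y). odd x \<and> even y} q + lattice_theta {(x, y). even x \<and> odd y} q"
    by (subst lattice_theta_Un[OF q, symmetric]) (auto intro!: arg_cong2[where f = lattice_theta])
  then have psi: "2 * q * psi q * psi (q^7)
     = lattice_theta {(x, y). odd x \<and> even y} q + lattice_theta {(x, y). even x \<and> odd y} q"
    using psi_mult_psi_7[OF q] by simp
  have "phi (- (q^2)) * phi (- (q^14)) = lattice_theta {(x, y). even x \<and> even y} (q^2) - lattice_theta {(x, y). odd x \<and> even y} (q^2)"
    using phi_mult_phi_7(2)[OF q2] by (simp flip: power_mult)
  then show ?thesis
    unfolding psi phi_mult_phi_7(1)[OF q] lattice_theta_relation[OF q, symmetric] by simp
qed

section \<open>The Lambert series as a logarithmic derivative\<close>

definition lambert :: "complex \<Rightarrow> complex" where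
  "lambert q = (\<Sum>n. q ^ (2 * Suc n - 1) / (1 - q ^ (2 * Suc n - 1))^2)"

lemma phi_minus_prodinf:
  assumes q: "norm q < 1" "q \<noteq> 0"
  shows "phi (-q) = (\<Prod>k. (1 - q * q ^ k) / (1 + q * q ^ k))"
proof -
  have q2: "norm (q^2) < 1"
    using q by (auto intro: norm_power_less_1)
  have "phi (-q) = euler_fun q ^ 2 / euler_fun (q^2)"
    using phi_minus_eq[OF q] euler_nonzero[OF q2] by (simp add: field_simps)
  also have "\<dots> = euler_fun q / qpoch_inf (-q) q"
    unfolding euler_double[OF q(1)] using euler_nonzero[OF q(1)] by (simp add: power2_eq_square)
  also have "\<dots> = (\<Prod>k. (1 - q * q ^ k) / (1 + q * q ^ k))"
    unfolding qpoch_inf_def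
    by (subst prodinf_divide) (use convergent_prod_qpoch[OF q(1), of q] convergent_prod_qpoch[OF q(1), of "-q"] in simp_all)
  finally show ?thesis .
qed

lemma phi_minus_nonzero:
  assumes q: "norm q < 1"
  shows "phi (-q) \<noteq> 0"
proof (cases "q = 0")
  case True
  have "phi 0 = (\<Sum>\<^sub>\<infinity>n\<in>{0::int}. 1)"
    unfolding phi_def by (rule infsum_cong_neutral) (auto simp: power_0_left)
  then show ?thesis using True by simp
next
  case False
  have "norm (q^2) < 1"
    using q by (auto intro: norm_power_less_1)
  then show ?thesis
    using phi_minus_eq[OF q False] euler_nonzero[OF q] by auto
qed

lemma one_plus_power_nonzero: "norm (q::complex) < 1 \<Longrightarrow> 1 + q * q ^ k \<noteq> 0"
  using norm_power_less_1[of q "Suc k"] norm_minus_cancel[of 1]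
  by (metis add_eq_0_iff less_irrefl norm_one power_Suc zero_less_Suc)

text \<open>Uniform convergence lets the logarithmic derivative be taken factor by factor. The
  origin is removed because the product formula was derived for nonzero q only.\<close>

lemma phi_minus_uniform_product:
  assumes r: "0 < r" "r < 1"
  shows "uniform_limit (ball 0 r - {0}) (\<lambda>n q. \<Prod>k<n. (1 - q * q ^ k) / (1 + q * q ^ k)) (\<lambda>q. phi (-q)) sequentially"
proof -
  let ?f = "\<lambda>k (q::complex). (1 - q * q ^ k) / (1 + q * q ^ k)"
  have in1: "norm q < 1" if "q \<in> cball 0 r" for q :: complex
    using that r by auto
  have "uniformly_convergent_on (cball 0 r) (\<lambda>n q. \<Prod>k<n. ?f k q)"
  proof (rule uniformly_convergent_on_prod')
    show "continuous_on (cball 0 r) (?f n)" for n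
      using in1 one_plus_power_nonzero by (intro continuous_intros) blast
    show "uniformly_convergent_on (cball 0 r) (\<lambda>N q. \<Sum>n<N. norm (?f n q - 1))"
    proof (rule Weierstrass_m_test')
      fix n and q :: complex assume q: "q \<in> cball 0 r"
      have nz: "1 + q * q ^ n \<noteq> 0"
        using in1[OF q] by (rule one_plus_power_nonzero)
      have "norm (q * q ^ n) \<le> r * r ^ n"
        unfolding norm_mult norm_power using q r by (intro mult_mono power_mono) auto
      moreover have "r * r ^ n \<le> r * 1"
        using r by (intro mult_left_mono) (auto intro: power_le_one)
      ultimately have "1 - r \<le> norm (1 + q * q ^ n)"
        using norm_diff_ineq[of 1 "q * q ^ n"] by simp
      then have "2 * norm (q * q ^ n) / norm (1 + q * q ^ n) \<le> 2 * (r * r ^ n) / (1 - r)"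
        using r \<open>norm (q * q ^ n) \<le> r * r ^ n\<close> by (intro frac_le) auto
      moreover have "?f n q - 1 = - 2 * (q * q ^ n) / (1 + q * q ^ n)"
        using nz by (simp add: field_simps)
      ultimately show "norm (norm (?f n q - 1)) \<le> 2 * r / (1 - r) * r ^ n"
        by (simp add: norm_divide norm_mult mult.assoc)
    next
      show "summable (\<lambda>n. 2 * r / (1 - r) * r ^ n)"
        using r by (intro summable_mult summable_geometric) auto
    qed
  qed auto
  then have "uniform_limit (cball 0 r) (\<lambda>n q. \<Prod>k<n. ?f k q) (\<lambda>q. lim (\<lambda>n. \<Prod>k<n. ?f k q)) sequentially"
    using uniformly_convergent_uniform_limit_iff by blast
  then have "uniform_limit (ball 0 r - {0}) (\<lambda>n q. \<Prod>k<n. ?f k q) (\<lambda>q. lim (\<lambda>n. \<Prod>k<n. ?f k q)) sequentially"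
    by (rule uniform_limit_on_subset) auto
  moreover have "lim (\<lambda>n. \<Prod>k<n. ?f k q) = phi (-q)" if "q \<in> ball 0 r - {0}" for q
  proof -
    have q: "norm q < 1" "q \<noteq> 0"
      using that r by auto
    have "convergent_prod (\<lambda>k. ?f k q)"
      using convergent_prod_divide[OF convergent_prod_qpoch[OF q(1), of q] convergent_prod_qpoch[OF q(1), of "-q"]] by simp
    then have "(\<lambda>n. \<Prod>k\<le>n. ?f k q) \<longlonglongrightarrow> phi (-q)"
      unfolding phi_minus_prodinf[OF q] by (rule convergent_prod_LIMSEQ)
    then have "(\<lambda>n. \<Prod>k<n. ?f k q) \<longlonglongrightarrow> phi (-q)"
      by (subst (asm) lessThan_Suc_atMost[symmetric]) (rule filterlim_sequentially_Suc[THEN iffD1])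
    then show ?thesis by (rule limI)
  qed
  moreover have "uniform_limit (ball 0 r - {0}) (\<lambda>n q. \<Prod>k<n. ?f k q) (\<lambda>q. lim (\<lambda>n. \<Prod>k<n. ?f k q)) sequentially
     \<longleftrightarrow> uniform_limit (ball 0 r - {0}) (\<lambda>n q. \<Prod>k<n. ?f k q) (\<lambda>q. phi (-q)) sequentially"
    by (rule uniform_limit_cong'[OF refl calculation(2)])
  ultimately show ?thesis
    by blast
qed

lemma lambert_summable:
  assumes q: "norm (q::complex) < 1"
  shows "(\<lambda>(k::nat, n::nat). of_nat (Suc k) * q ^ (Suc k * (2 * n + 1))) summable_on UNIV \<times> UNIV"
proof -
  define r where "r = norm q"
  have r: "0 \<le> r" "r < 1"
    using q by (auto simp: r_def)
  have "(\<lambda>(k::nat, n::nat). real (Suc k) * r ^ (Suc k * (2 * n + 1))) summable_on UNIV \<times> UNIV"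
  proof (rule summable_on_SigmaI)
    fix k :: nat
    have lt: "(r ^ Suc k)^2 < 1"
    proof -
      have "r ^ Suc k < 1"
        using r by (simp only: power_less_one_iff zero_less_Suc)
      then show ?thesis
        using r by (simp only: power_less_one_iff zero_le_power zero_less_numeral)
    qed
    have e: "real (Suc k) * r ^ (Suc k * (2 * n + 1)) = real (Suc k) * r ^ Suc k * ((r ^ Suc k)^2) ^ n" for n
      by (simp add: power_mult[symmetric] power_add[symmetric] algebra_simps del: power_Suc)
    have "(\<lambda>n. real (Suc k) * r ^ (Suc k * (2 * n + 1))) sums (real (Suc k) * r ^ Suc k * (1 / (1 - (r ^ Suc k)^2)))"
      unfolding e using lt r by (intro sums_mult geometric_sums) auto
    then show "((\<lambda>n. case (k, n) of (k, n) \<Rightarrow> real (Suc k) * r ^ (Suc k * (2 * n + 1))) has_sum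
       real (Suc k) * r ^ Suc k * (1 / (1 - (r ^ Suc k)^2))) UNIV"
      unfolding prod.case using r by (intro sums_nonneg_imp_has_sum) auto
  next
    have "summable (\<lambda>k. (1 + real k)^2 * r ^ k * (1 / (1 - r^2)))"
      using r by (intro summable_mult2 summable_square_geometric)
    then have "summable (\<lambda>k. real (Suc k) * r ^ Suc k * (1 / (1 - (r ^ Suc k)^2)))"
    proof (rule summable_comparison_test'[where N = 0])
      fix k :: nat
      have "(r ^ Suc k)^2 \<le> r^2"
        using r power_decreasing[of 1 "Suc k" r] by (intro power_mono) auto
      moreover have "r^2 < 1"
        using r by (simp add: power_less_one_iff)
      ultimately have b: "1 / (1 - (r ^ Suc k)^2) \<le> 1 / (1 - r^2)" "0 \<le> 1 / (1 - (r ^ Suc k)^2)"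
        by (auto intro!: frac_le)
      have c: "real (Suc k) * r ^ Suc k \<le> (1 + real k)^2 * r ^ k"
        using r by (intro mult_mono) (auto simp: power2_eq_square intro: mult_left_le_one_le)
      have "0 \<le> (1 + real k)^2 * r ^ k" "0 \<le> real (Suc k) * r ^ Suc k"
        using r by (simp_all del: power_Suc)
      then show "norm (real (Suc k) * r ^ Suc k * (1 / (1 - (r ^ Suc k)^2))) \<le> (1 + real k)^2 * r ^ k * (1 / (1 - r^2))"
        using mult_mono[OF c b(1) _ b(2)] mult_nonneg_nonneg[OF _ b(2)] unfolding real_norm_def
        by (simp only: abs_of_nonneg)
    qed
    then show "(\<lambda>k. real (Suc k) * r ^ Suc k * (1 / (1 - (r ^ Suc k)^2))) summable_on UNIV"
      using r by (intro summable_nonneg_imp_summable_on) (auto intro!: mult_nonneg_nonneg divide_nonneg_nonneg simp: power_le_one simp del: power_Suc)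
  qed (use r in auto)
  then have "(\<lambda>p. norm (case p of (k::nat, n::nat) \<Rightarrow> of_nat (Suc k) * q ^ (Suc k * (2 * n + 1)))) summable_on UNIV \<times> UNIV"
    by (simp add: case_prod_unfold norm_mult norm_power r_def del: of_nat_Suc)
  then show ?thesis
    by (rule abs_summable_summable)
qed

text \<open>Both series are iterated sums of k q^(k m) over k at least 1 and odd m: summing over k
  first gives the definition, summing over m first gives the form produced by a product with one
  factor for every exponent k.\<close>

lemma lambert_eq:
  assumes q: "norm q < 1"
  shows "(\<lambda>k. of_nat (Suc k) * q ^ Suc k / (1 - (q ^ Suc k)^2)) sums lambert q"
proof -
  let ?F = "\<lambda>k n. of_nat (Suc k) * q ^ (Suc k * (2 * n + 1))"
  note s = lambert_summable[OF q]
  have lt: "norm (q ^ Suc k) < 1" for k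
    using q by (rule norm_power_less_1) simp
  have 1: "((\<lambda>n. ?F k n) has_sum of_nat (Suc k) * q ^ Suc k / (1 - (q ^ Suc k)^2)) UNIV" for k
  proof (rule norm_summable_imp_has_sum)
    define x where "x = (q ^ Suc k)^2"
    have x: "norm x < 1"
      unfolding x_def using lt by (rule norm_power_less_1) simp
    have e: "?F k n = of_nat (Suc k) * q ^ Suc k * x ^ n" for n
      by (simp add: x_def power_mult[symmetric] power_add[symmetric] algebra_simps del: power_Suc)
    show "(\<lambda>n. ?F k n) sums (of_nat (Suc k) * q ^ Suc k / (1 - (q ^ Suc k)^2))"
      unfolding e x_def[symmetric] using sums_mult[OF geometric_sums[OF x], of "of_nat (Suc k) * q ^ Suc k"] by simp
    show "summable (\<lambda>n. norm (?F k n))"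
      unfolding e norm_mult[of _ "x ^ n" for n] norm_power[of x]
      using x by (intro summable_mult summable_geometric) simp
  qed
  have 2: "((\<lambda>k. ?F k n) has_sum q ^ (2 * Suc n - 1) / (1 - q ^ (2 * Suc n - 1))^2) UNIV" for n
  proof (rule norm_summable_imp_has_sum)
    define p where "p = q ^ (2 * n + 1)"
    have p: "norm p < 1"
      unfolding p_def using q by (rule norm_power_less_1) simp
    have e: "?F k n = p * (of_nat (Suc k) * p ^ k)" for k
    proof -
      have "q ^ (Suc k * (2 * n + 1)) = p * p ^ k"
        unfolding p_def power_mult[symmetric] power_add[symmetric] by (simp add: algebra_simps)
      then show ?thesis by simp
    qed
    have pe: "q ^ (2 * Suc n - 1) = p"
      by (simp add: p_def)
    show "(\<lambda>k. ?F k n) sums (q ^ (2 * Suc n - 1) / (1 - q ^ (2 * Suc n - 1))^2)"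
      unfolding e pe using sums_mult[OF geometric_deriv_sums[OF p], of p] by simp
    have "summable (\<lambda>k. norm p * ((1 + real k)^2 * norm p ^ k))"
      using p by (intro summable_mult summable_square_geometric) auto
    then show "summable (\<lambda>k. norm (?F k n))"
      unfolding e
    proof (rule summable_comparison_test'[where N = 0])
      fix k :: nat
      have "real (Suc k) \<le> (1 + real k)^2"
        by (simp add: power2_eq_square algebra_simps)
      then show "norm (norm (p * (of_nat (Suc k) * p ^ k))) \<le> norm p * ((1 + real k)^2 * norm p ^ k)"
        by (simp add: norm_mult norm_power mult_left_mono mult_right_mono del: of_nat_Suc)
    qed
  qed
  have h1: "((\<lambda>(k, n). ?F k n) has_sum (\<Sum>\<^sub>\<infinity>(k, n). ?F k n)) (UNIV \<times> UNIV)"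
    using s by (simp add: has_sum_iff)
  then have h2: "((\<lambda>(n, k). ?F k n) has_sum (\<Sum>\<^sub>\<infinity>(k, n). ?F k n)) (UNIV \<times> UNIV)"
    by (subst (asm) has_sum_swap) (simp add: case_prod_unfold)
  have h3: "((\<lambda>k. of_nat (Suc k) * q ^ Suc k / (1 - (q ^ Suc k)^2)) has_sum (\<Sum>\<^sub>\<infinity>(k, n). ?F k n)) UNIV"
    by (rule has_sum_SigmaD[OF h1]) (use 1 in simp)
  have "((\<lambda>n. q ^ (2 * Suc n - 1) / (1 - q ^ (2 * Suc n - 1))^2) has_sum (\<Sum>\<^sub>\<infinity>(k, n). ?F k n)) UNIV"
    by (rule has_sum_SigmaD[OF h2]) (use 2 in simp)
  from sums_unique[OF has_sum_imp_sums[OF this]] have "lambert q = (\<Sum>\<^sub>\<infinity>(k, n). ?F k n)"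
    unfolding lambert_def by (rule sym)
  then show ?thesis
    using has_sum_imp_sums[OF h3] by simp
qed

text \<open>With p = q^(k+1), the factor (1 - p)/(1 + p) contributes -2 (k+1) p / (1 - p^2), which
  is -2 times a term of \<open>lambert_eq\<close>.\<close>

lemma phi_minus_logderiv:
  assumes q: "norm q < 1" "q \<noteq> 0"
  shows "q * deriv (\<lambda>q. phi (-q)) q = - 2 * lambert q * phi (-q)"
proof -
  define r where "r = (1 + norm q) / 2"
  have r: "0 < r" "r < 1" "norm q < r"
    using q by (auto simp: r_def field_simps add_pos_nonneg)
  let ?A = "ball 0 r - {0} :: complex set"
  let ?f = "\<lambda>k (q::complex). (1 - q * q ^ k) / (1 + q * q ^ k)"
  have in1: "norm x < 1" if "x \<in> ?A" for x
    using that r by auto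
  have "(\<lambda>k. deriv (?f k) q / ?f k q) sums (deriv (\<lambda>q. phi (-q)) q / phi (-q))"
  proof (rule logderiv_prodinf_complex_uniform_limit)
    show "uniform_limit ?A (\<lambda>n x. \<Prod>k<n. ?f k x) (\<lambda>q. phi (-q)) sequentially"
      by (rule phi_minus_uniform_product[OF r(1,2)])
    show "?f k holomorphic_on ?A" for k
      using in1 one_plus_power_nonzero by (intro holomorphic_intros) blast
    show "open ?A"
      by (intro open_Diff) auto
  qed (use r q phi_minus_nonzero in auto)
  then have "(\<lambda>k. - (q / 2) * (deriv (?f k) q / ?f k q)) sums (- (q / 2) * (deriv (\<lambda>q. phi (-q)) q / phi (-q)))"
    by (rule sums_mult)
  moreover have "- (q / 2) * (deriv (?f k) q / ?f k q) = of_nat (Suc k) * q ^ Suc k / (1 - (q ^ Suc k)^2)" for k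
  proof -
    define p where "p = q * q ^ k"
    have nz: "1 + p \<noteq> 0" "1 - p \<noteq> 0"
      unfolding p_def by (intro one_plus_power_nonzero one_minus_power_nonzero q)+
    have d: "((\<lambda>q. q * q ^ k) has_field_derivative of_nat (Suc k) * q ^ k) (at q)"
    proof -
      have "((\<lambda>q. q ^ Suc k) has_field_derivative of_nat (Suc k) * q ^ k) (at q)"
        by (rule derivative_eq_intros refl)+ simp
      then show ?thesis by simp
    qed
    define D where "D = of_nat (Suc k) * q ^ k"
    have "(?f k has_field_derivative ((0 - D) * (1 + q * q ^ k) - (1 - q * q ^ k) * (0 + D)) / ((1 + q * q ^ k) * (1 + q * q ^ k))) (at q)"
      using nz(1) unfolding p_def by (intro DERIV_divide DERIV_diff DERIV_add DERIV_const d[folded D_def])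
    then have "deriv (?f k) q = - 2 * D / (1 + p)^2"
      using nz by (simp add: DERIV_imp_deriv p_def field_simps power2_eq_square)
    then have "deriv (?f k) q = - 2 * (of_nat (Suc k) * q ^ k) / (1 + p)^2"
      by (simp add: D_def)
    then have "- (q / 2) * (deriv (?f k) q / ?f k q) = (of_nat (Suc k) * p) / ((1 + p)^2 * ((1 - p) / (1 + p)))"
      by (simp add: p_def)
    also have "\<dots> = of_nat (Suc k) * p / (1 - p^2)"
    proof -
      have "(1 + p)^2 * ((1 - p) / (1 + p)) = 1 - p^2"
        using nz by (simp add: power2_eq_square) (simp add: algebra_simps)
      then show ?thesis by simp
    qed
    finally show ?thesis
      by (simp add: p_def)
  qed
  ultimately have "lambert q = - (q / 2) * (deriv (\<lambda>q. phi (-q)) q / phi (-q))"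
    using lambert_eq[OF q(1)] sums_unique2 by simp
  then show ?thesis
    using phi_minus_nonzero[OF q(1)] by (simp add: field_simps)
qed

text \<open>v is the logarithmic derivative for q d/dq, but without division by \<open>f q\<close>:
  constants, including 0, get the value 0, and the product rule needs no nonvanishing.\<close>

definition has_log_deriv :: "(complex \<Rightarrow> complex) \<Rightarrow> complex \<Rightarrow> complex \<Rightarrow> bool" where
  "has_log_deriv f v q \<longleftrightarrow> (f has_field_derivative f q * v / q) (at q)"

lemma has_log_derivI:
  assumes "f field_differentiable at q" "q * deriv f q = f q * v" "q \<noteq> 0"
  shows "has_log_deriv f v q"
proof -
  have "deriv f q = f q * v / q"
    using assms(2,3) by (simp add: field_simps)
  then show ?thesis
    using assms(1) unfolding has_log_deriv_def by (metis field_differentiable_derivI)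
qed

lemma has_log_derivD: "has_log_deriv f v q \<Longrightarrow> q \<noteq> 0 \<Longrightarrow> q * deriv f q = f q * v"
  unfolding has_log_deriv_def using DERIV_imp_deriv by fastforce

lemma has_log_deriv_const: "has_log_deriv (\<lambda>_. c) 0 q"
  by (simp add: has_log_deriv_def)

lemma has_log_deriv_id: "q \<noteq> 0 \<Longrightarrow> has_log_deriv (\<lambda>q. q) 1 q"
  by (simp add: has_log_deriv_def)

lemma has_log_deriv_mult:
  "has_log_deriv f u q \<Longrightarrow> has_log_deriv g v q \<Longrightarrow> has_log_deriv (\<lambda>q. f q * g q) (u + v) q"
  unfolding has_log_deriv_def
  by (drule (1) DERIV_mult) (simp add: algebra_simps add_divide_distrib)

lemma has_log_deriv_power:
  "has_log_deriv f u q \<Longrightarrow> has_log_deriv (\<lambda>q. f q ^ n) (of_nat n * u) q"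
proof (induction n)
  case (Suc n)
  then show ?case
    using has_log_deriv_mult[of f u q "\<lambda>q. f q ^ n" "of_nat n * u"] by (simp add: algebra_simps)
qed (simp add: has_log_deriv_const)

lemma has_log_deriv_compose_power:
  assumes "has_log_deriv f v (q ^ n)" "q \<noteq> 0" "n > 0"
  shows "has_log_deriv (\<lambda>q. f (q ^ n)) (of_nat n * v) q"
proof -
  have "((\<lambda>q. q ^ n) has_field_derivative of_nat n * q ^ (n - 1)) (at q)"
    by (auto intro!: derivative_eq_intros)
  from DERIV_chain2[OF assms(1)[unfolded has_log_deriv_def] this]
  have "((\<lambda>q. f (q ^ n)) has_field_derivative f (q ^ n) * v / q ^ n * (of_nat n * q ^ (n - 1))) (at q)" .
  moreover have "q ^ n = q * q ^ (n - 1)"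
    using assms(3) by (cases n) auto
  ultimately show ?thesis
    using assms(2) by (simp add: has_log_deriv_def field_simps)
qed

text \<open>For phi(-q^2) and psi(q), which are reached through their squares phi(q) phi(-q) and
  phi(q) psi(q^2).\<close>

lemma has_log_deriv_sqrt:
  assumes "has_log_deriv f v q" "g field_differentiable at q" "g q \<noteq> 0" "q \<noteq> 0"
    and "open A" "q \<in> A" "\<And>x. x \<in> A \<Longrightarrow> g x ^ 2 = f x"
  shows "has_log_deriv g (v / 2) q"
proof (rule has_log_derivI[OF assms(2) _ assms(4)])
  have "((\<lambda>x. g x ^ 2) has_field_derivative 2 * g q * deriv g q) (at q)"
    using field_differentiable_derivI[OF assms(2)] by (auto intro!: derivative_eq_intros)
  moreover have "((\<lambda>x. g x ^ 2) has_field_derivative f q * v / q) (at q)"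
    by (rule has_field_derivative_transform_within_open[OF assms(1)[unfolded has_log_deriv_def] assms(5,6)])
       (simp add: assms(7))
  ultimately have "2 * g q * deriv g q = f q * v / q"
    by (rule DERIV_unique)
  also have "\<dots> = g q ^ 2 * v / q"
    by (simp add: assms(6,7))
  finally show "q * deriv g q = g q * (v / 2)"
    using assms(3,4) by (simp add: field_simps power2_eq_square)
qed

section \<open>Logarithmic derivatives of the theta functions\<close>

lemma psi_holomorphic: "psi holomorphic_on ball 0 1"
proof -
  have "real (nat (n * (n + 1) div 2)) \<le> 4 * (1 + \<bar>real_of_int n\<bar>)^2" for n
  proof -
    have "nat (n * (n + 1) div 2) \<le> nat (n * (n + 1))"
      using two_tri(1)[of n] tri_nonneg(1)[of n] by linarith
    then show ?thesis
      using square_weight_bounds(2)[of n] by linarith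
  qed
  then show ?thesis
    unfolding psi_def[abs_def]
    by (intro holomorphic_intros theta_holomorphic_deriv(1) nat_exponent_bounds) auto
qed

lemma
  assumes "norm q < 1"
  shows phi_differentiable: "phi field_differentiable at q"
    and psi_differentiable: "psi field_differentiable at q"
    and psi_sq_differentiable: "(\<lambda>q. psi (q^2)) field_differentiable at q"
  using assms phi_holomorphic psi_holomorphic psi_sq_holomorphic
  by (auto intro!: holomorphic_on_imp_differentiable_at)

lemma phi_minus_differentiable:
  assumes "norm q < 1"
  shows "(\<lambda>q. phi (-q)) field_differentiable at q"
proof -
  have "phi \<circ> uminus field_differentiable at q"
    using phi_differentiable[of "-q"] assms by (intro field_differentiable_compose) (auto intro!: derivative_intros)
  then show ?thesis by (simp add: o_def)
qed

lemma psi_nonzero: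
  assumes "norm q < 1" "q \<noteq> 0"
  shows "psi q \<noteq> 0"
proof -
  have "norm (q^2) < 1"
    using assms by (auto intro: norm_power_less_1)
  then show ?thesis
    using psi_eq[OF assms] euler_nonzero[of "q^2"] by auto
qed

lemma phi_nonzero: "norm q < 1 \<Longrightarrow> phi q \<noteq> 0"
  using phi_minus_nonzero[of "-q"] by simp

context
  fixes q :: complex
  assumes q: "norm q < 1" "q \<noteq> 0"
begin

lemma phi_minus_log_deriv: "has_log_deriv (\<lambda>q. phi (-q)) (- 2 * lambert q) q"
  by (rule has_log_derivI[OF phi_minus_differentiable[OF q(1)] _ q(2)])
     (use phi_minus_logderiv[OF q] in \<open>simp add: mult_ac\<close>)

text \<open>The derivative formula at \<open>-q\<close> brings in \<open>phi (-q)\<close>, whose logarithmic derivative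
  is known from its product.\<close>
lemma psi_sq_log_deriv: "has_log_deriv (\<lambda>q. psi (q^2)) (- 2 * lambert q + (phi q ^ 4 - 1) / 4) q"
proof (rule has_log_derivI[OF psi_sq_differentiable[OF q(1)] _ q(2)])
  let ?P = "\<lambda>q. psi (q^2)"
  have q': "norm (-q) < 1" "-q \<noteq> 0"
    using q by auto
  have d1: "(phi has_field_derivative deriv phi (-q)) (at (-q))"
    using phi_differentiable[OF q'(1)] by (rule field_differentiable_derivI)
  have d2: "(?P has_field_derivative deriv ?P (-q)) (at (-q))"
    using psi_sq_differentiable[OF q'(1)] by (rule field_differentiable_derivI)
  have m: "(uminus has_field_derivative -1) (at q)"
    by (auto intro!: derivative_eq_intros)
  have "deriv (\<lambda>q. phi (-q)) q = - deriv phi (-q)"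
    using DERIV_chain2[OF d1 m] by (intro DERIV_imp_deriv) simp
  then have 1: "-q * deriv phi (-q) = - 2 * lambert q * phi (-q)"
    using phi_minus_logderiv[OF q] by simp
  have "deriv ?P q = - deriv ?P (-q)"
    using DERIV_chain2[OF d2 m] by (intro DERIV_imp_deriv) simp
  then have 2: "-q * deriv ?P (-q) = q * deriv ?P q"
    by simp
  have "phi (-q) * (psi (q^2) + 4 * (q * deriv ?P q)) - 4 * (- 2 * lambert q * phi (-q)) * psi (q^2) = phi q ^ 4 * phi (-q) * psi (q^2)"
    using theta_quotient_deriv[OF q'] unfolding 1 2 by simp
  then have "phi (-q) * (psi (q^2) + 4 * (q * deriv ?P q) + 8 * lambert q * psi (q^2) - phi q ^ 4 * psi (q^2)) = 0"
    by (simp add: algebra_simps)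
  then have "psi (q^2) + 4 * (q * deriv ?P q) + 8 * lambert q * psi (q^2) - phi q ^ 4 * psi (q^2) = 0"
    using phi_minus_nonzero[OF q(1)] by simp
  then show "q * deriv ?P q = psi (q^2) * (- 2 * lambert q + (phi q ^ 4 - 1) / 4)"
    by (simp add: field_simps)
qed

text \<open>Now the derivative formula is used at q itself, with psi(q^2) already known;
  \<open>jacobi_quartic\<close> eliminates phi(-q)^4.\<close>

lemma phi_log_deriv: "has_log_deriv phi (- 2 * lambert q + 4 * q * psi (q^2) ^ 4) q"
proof (rule has_log_derivI[OF phi_differentiable[OF q(1)] _ q(2)])
  let ?P = "\<lambda>q. psi (q^2)"
  have nz: "psi (q^2) \<noteq> 0"
    using q by (intro psi_nonzero norm_power_less_1) auto
  have 1: "4 * (q * deriv ?P q) = psi (q^2) * (- 8 * lambert q + phi q ^ 4 - 1)"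
    unfolding has_log_derivD[OF psi_sq_log_deriv q(2)] by (simp add: field_simps)
  have "phi q ^ 4 = phi (-q) ^ 4 + 16 * q * psi (q^2) ^ 4"
    by (rule jacobi_quartic[OF q(1)])
  then have 2: "phi (-q) ^ 4 = phi q ^ 4 - 16 * q * psi (q^2) ^ 4"
    by simp
  have "(4 * psi (q^2)) * (q * deriv phi q) = (4 * psi (q^2)) * (phi q * (- 2 * lambert q + 4 * q * psi (q^2) ^ 4))"
    using theta_quotient_deriv[OF q] unfolding 1 2 by algebra
  then show "q * deriv phi q = phi q * (- 2 * lambert q + 4 * q * psi (q^2) ^ 4)"
    using nz by simp
qed

lemma phi_minus_sq_log_deriv:
  "has_log_deriv (\<lambda>q. phi (- (q^2))) (- 2 * lambert q + 2 * q * psi (q^2) ^ 4) q"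
proof -
  have "has_log_deriv (\<lambda>q. phi (- (q^2))) ((- 2 * lambert q + 4 * q * psi (q^2) ^ 4 + (- 2 * lambert q)) / 2) q"
  proof (rule has_log_deriv_sqrt[OF has_log_deriv_mult[OF phi_log_deriv phi_minus_log_deriv]])
    have q2: "norm (q^2) < 1"
      using q by (auto intro: norm_power_less_1)
    then show "phi (- (q^2)) \<noteq> 0"
      by (rule phi_minus_nonzero)
    have "(\<lambda>q. phi (- q)) \<circ> (\<lambda>q. q^2) field_differentiable at q"
      by (intro field_differentiable_compose phi_minus_differentiable q2) (auto intro!: derivative_intros)
    then show "(\<lambda>q. phi (- (q^2))) field_differentiable at q"
      by (simp add: o_def)
    show "phi (- (x^2)) ^ 2 = phi x * phi (- x)" if "x \<in> ball 0 1" for x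
      using phi_mult_phi_minus[of x] that by simp
  qed (use q in auto)
  moreover have "(- 2 * lambert q + 4 * q * psi (q^2) ^ 4 + (- 2 * lambert q)) / 2 = - 2 * lambert q + 2 * q * psi (q^2) ^ 4"
    by (simp add: field_simps)
  ultimately show ?thesis by (simp only:)
qed

lemma psi_log_deriv:
  "has_log_deriv psi (- 2 * lambert q + 2 * q * psi (q^2) ^ 4 + (phi q ^ 4 - 1) / 8) q"
proof -
  have "has_log_deriv psi ((- 2 * lambert q + 4 * q * psi (q^2) ^ 4 + (- 2 * lambert q + (phi q ^ 4 - 1) / 4)) / 2) q"
  proof (rule has_log_deriv_sqrt[OF has_log_deriv_mult[OF phi_log_deriv psi_sq_log_deriv]])
    show "psi x ^ 2 = phi x * psi (x^2)" if "x \<in> ball 0 1" for x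
      using psi_square[of x] that by simp
  qed (use q psi_nonzero psi_differentiable in auto)
  moreover have "(- 2 * lambert q + 4 * q * psi (q^2) ^ 4 + (- 2 * lambert q + (phi q ^ 4 - 1) / 4)) / 2
      = - 2 * lambert q + 2 * q * psi (q^2) ^ 4 + (phi q ^ 4 - 1) / 8"
    by (simp add: field_simps)
  ultimately show ?thesis by (simp only:)
qed

end

section \<open>The cubic relation\<close>

text \<open>With \<open>\<alpha> = M / X\<close> and \<open>\<beta> = N / Y\<close> the hypotheses describe the modular curve of degree 7
  in the parameter \<open>t = (\<alpha>\<beta>)\<^bsup>1/8\<^esup>\<close>: \<open>\<alpha> + \<beta> = 1 + t^8 - (1 - t)^8\<close>.  The factor
  \<open>t X - M\<close> is determined up to sign, and excluding one sign makes everything rational in \<open>t\<close>.\<close>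
lemma degree_7_algebra:
  fixes h t X Y M N l l' W :: complex
  defines "d \<equiv> t * (1 - t) * (1 - t + t^2)"
  assumes 1: "M + N = t * (X + Y)"
    and 2: "X * Y = 7 * h^4"
    and 3: "M * N = 7 * t^8 * h^4"
    and 4: "(X - M) * (Y - N) = 7 * (1 - t)^8 * h^4"
    and 5: "t * (X + Y) * (M + N - X - Y) / 8 + (M * (4 * l + X) + N * (4 * l' + Y))
      = t * (X * (4 * l + M) + Y * (4 * l' + N))"
    and W: "W = (l' - l) / 2"
    and nz: "h \<noteq> 0" "d \<noteq> 0" "t * X - M \<noteq> 7 * h^2 * d"
  shows "W^3 + (t * h)^2 * W^2 - 3 / 16 * (t * h)^4 * W - (t * h)^2 / 64 * (M * X + N * Y + 4 * (t * h)^4) = 0"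
proof -
  define \<delta> where "\<delta> = t * X - M"
  \<comment> \<open>The quotient of 1 + t^8 - (1 - t)^8 - 2t, that is alpha + beta - 2t, by
    d.\<close>
  define u where "u = 6 - 16 * t + 12 * t^2 - 8 * t^3"
  have M: "M = t * X - \<delta>"
    by (simp add: \<delta>_def)
  have N: "N = t * Y + \<delta>"
    using 1 by (simp add: \<delta>_def algebra_simps)
  have \<sigma>: "1 + t^8 - (1 - t)^8 - 2 * t = u * d"
    unfolding u_def d_def by algebra
  have NX: "X * N + Y * M = 7 * h^4 * (1 + t^8 - (1 - t)^8)"
    using 2 3 4 by algebra
  have "\<delta>^2 = t * (X * N + Y * M) - t^2 * (X * Y) - M * N"
    unfolding M N by algebra
  also have "\<dots> = 7 * h^4 * (t * (1 + t^8 - (1 - t)^8) - t^2 - t^8)"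
    unfolding NX 2 3 by algebra
  \<comment> \<open>Here t (1 + t^8 - (1 - t)^8) - t^2 - t^8 = t (1 - t) (1 - t^7 - (1 - t)^7), and
    Cauchy's identity evaluates the last factor as 7 t (1 - t) (1 - t + t^2)^2.\<close>
  also have "\<dots> = (7 * h^2 * d)^2"
    unfolding d_def by algebra
  finally have "(\<delta> - 7 * h^2 * d) * (\<delta> + 7 * h^2 * d) = 0"
    by algebra
  then have \<delta>: "\<delta> = - 7 * h^2 * d"
    using nz(3) unfolding \<delta>_def[symmetric] by (simp add: eq_neg_iff_add_eq_0)
  have "X * N + Y * M = 2 * t * (X * Y) + \<delta> * (X - Y)"
    unfolding M N by algebra
  then have "\<delta> * (X - Y) = 7 * h^4 * (u * d)"
    unfolding NX 2 \<sigma>[symmetric] by algebra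
  then have "(7 * h^2 * d) * (X - Y) = (7 * h^2 * d) * (- (h^2 * u))"
    unfolding \<delta> by algebra
  moreover have nz7: "7 * h^2 * d \<noteq> 0"
    using nz by simp
  ultimately have XY: "X - Y = - (h^2 * u)"
    by (simp only: mult_cancel_left) simp
  have T: "(X + Y)^2 = h^4 * (u^2 + 28)"
  proof -
    have "(X + Y)^2 = (X - Y)^2 + 4 * (X * Y)" by algebra
    then show ?thesis unfolding XY 2 by algebra
  qed
  have R: "M * X + N * Y = h^4 * (t * (u^2 + 14) - 7 * u * d)"
  proof -
    have "M * X + N * Y = t * ((X - Y)^2 + 2 * (X * Y)) - \<delta> * (X - Y)"
      unfolding M N by algebra
    then show ?thesis unfolding XY 2 \<delta> by algebra
  qed
  \<comment> \<open>In hypothesis 5 the variable l has coefficient 4 (M - t X) = -4 \<delta> and l'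
    has 4 (N - t Y) = 4 \<delta>, so only l' - l matters.\<close>
  have "8 * W * \<delta> = 4 * (l' - l) * \<delta>"
    unfolding W by simp
  also have "\<dots> = (1 - t) * (t * (X + Y)^2 / 8 - (M * X + N * Y))"
  proof -
    have "t * (X + Y) * (M + N - X - Y) / 8 = - (1 - t) * t * (X + Y)^2 / 8"
      unfolding M N by (simp add: field_simps power2_eq_square)
    then show ?thesis
      using 5 unfolding M N by (simp add: field_simps power2_eq_square)
  qed
  finally have "8 * W * (- 7 * h^2 * d) = (1 - t) * (t * (h^4 * (u^2 + 28)) / 8 - h^4 * (t * (u^2 + 14) - 7 * u * d))"
    unfolding T R \<delta> .
  also have "\<dots> = (- 7 * h^2 * d) * (2 * h^2 * t * (2 - t + 2 * t^2))"
    unfolding u_def d_def by (simp add: field_simps) algebra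
  finally have "(- 7 * h^2 * d) * (8 * W) = (- 7 * h^2 * d) * (2 * h^2 * t * (2 - t + 2 * t^2))"
    by (simp add: mult_ac)
  then have "8 * W = 2 * h^2 * t * (2 - t + 2 * t^2)"
    using nz by (simp only: mult_cancel_left) simp
  also have "\<dots> = 8 * (h^2 * t * (2 - t + 2 * t^2) / 4)"
    by (simp add: field_simps)
  finally have W': "W = h^2 * t * (2 - t + 2 * t^2) / 4"
    by (simp only: mult_cancel_left) simp
  show ?thesis
    unfolding R unfolding W' u_def d_def by (simp add: field_simps) algebra
qed

section \<open>The modular equation and its derivatives\<close>

definition mod_h :: "complex \<Rightarrow> complex" where "mod_h q = phi q * phi (q^7)"
definition mod_k :: "complex \<Rightarrow> complex" where "mod_k q = 2 * (q * (psi q * psi (q^7)))"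

definition form_X :: "complex \<Rightarrow> complex" where "form_X q = phi q ^ 4"
definition form_M :: "complex \<Rightarrow> complex" where "form_M q = 16 * (q * psi (q^2) ^ 4)"

definition weight2 :: "complex \<Rightarrow> complex" where "weight2 q = lambert q - 7 * lambert (q^7)"

text \<open>The theorem's cubic times Pi_{q^7}^6, written with W = z Pi_{q^7}^2 and
  \<open>mod_k q ^ 2\<close> = 4 Pi_q Pi_{q^7}. This clears all denominators and fractional powers,
  so it makes sense on the whole unit disc.\<close>

definition cubic_defect :: "complex \<Rightarrow> complex" where
  "cubic_defect q = weight2 q ^ 3 + mod_k q ^ 2 * weight2 q ^ 2 - 3 / 16 * mod_k q ^ 4 * weight2 q
     - mod_k q ^ 2 / 64 * (16 * q * psi q ^ 8 + 784 * q^7 * psi (q^7) ^ 8 + 4 * mod_k q ^ 4)"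

lemma norm_power7: "norm (q::complex) < 1 \<Longrightarrow> norm (q^7) < 1"
  by (rule norm_power_less_1) auto

lemma mod_equation:
  "norm q < 1 \<Longrightarrow> mod_h q = phi (- (q^2)) * phi (- ((q^7)^2)) + mod_k q"
  using modular_equation_7[of q] by (simp add: mod_h_def mod_k_def mult.assoc flip: power_mult)

lemma log_derivs:
  assumes q: "norm q < 1" "q \<noteq> 0"
  defines "l \<equiv> - 2 * lambert q" and "l' \<equiv> - 14 * lambert (q^7)"
    and "X \<equiv> form_X q" and "M \<equiv> form_M q" and "Y \<equiv> 7 * form_X (q^7)" and "N \<equiv> 7 * form_M (q^7)"
  shows "has_log_deriv mod_h (l + l' + (M + N) / 4) q"
    and "has_log_deriv mod_k (l + l' + (M + N + X + Y) / 8) q"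
    and "has_log_deriv (\<lambda>q. phi (- (q^2)) * phi (- ((q^7)^2))) (l + l' + (M + N) / 8) q"
    and "has_log_deriv form_X (4 * l + M) q"
    and "has_log_deriv form_M (4 * l + X) q"
    and "has_log_deriv (\<lambda>q. form_X (q^7)) (4 * l' + N) q"
    and "has_log_deriv (\<lambda>q. form_M (q^7)) (4 * l' + Y) q"
proof -
  have q7: "norm (q^7) < 1" "q^7 \<noteq> 0"
    using q norm_power7 by auto
  note lift = has_log_deriv_compose_power[OF _ q(2), of _ _ 7, simplified]
  \<comment> \<open>Allows each composition rule to produce its own value and leaves the equality
    with the wanted value to the simplifier.\<close>
  note c = back_subst[of "\<lambda>v. has_log_deriv f v q" for f]
  have X: "has_log_deriv form_X (of_nat 4 * (- 2 * lambert x + 4 * x * psi (x^2) ^ 4)) x"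
    and M: "has_log_deriv form_M (0 + (1 + of_nat 4 * (- 2 * lambert x + (phi x ^ 4 - 1) / 4))) x"
    if "norm x < 1" "x \<noteq> 0" for x
    unfolding form_X_def[abs_def] form_M_def[abs_def]
    by (intro has_log_deriv_mult has_log_deriv_const has_log_deriv_id has_log_deriv_power
        phi_log_deriv psi_sq_log_deriv that)+
  show "has_log_deriv mod_h (l + l' + (M + N) / 4) q"
    unfolding mod_h_def[abs_def]
    by (rule c[OF has_log_deriv_mult[OF phi_log_deriv[OF q] lift[OF phi_log_deriv[OF q7]]]])
       (simp add: l_def l'_def M_def N_def form_M_def algebra_simps)
  show "has_log_deriv mod_k (l + l' + (M + N + X + Y) / 8) q"
    unfolding mod_k_def[abs_def]
    by (rule c[OF has_log_deriv_mult[OF has_log_deriv_const has_log_deriv_mult[OF has_log_deriv_id[OF q(2)]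
          has_log_deriv_mult[OF psi_log_deriv[OF q] lift[OF psi_log_deriv[OF q7]]]]]])
       (simp add: l_def l'_def M_def N_def X_def Y_def form_M_def form_X_def field_simps)
  show "has_log_deriv (\<lambda>q. phi (- (q^2)) * phi (- ((q^7)^2))) (l + l' + (M + N) / 8) q"
    by (rule c[OF has_log_deriv_mult[OF phi_minus_sq_log_deriv[OF q] lift[OF phi_minus_sq_log_deriv[OF q7]]]])
       (simp add: l_def l'_def M_def N_def form_M_def field_simps)
  show "has_log_deriv form_X (4 * l + M) q"
    by (rule c[OF X[OF q]]) (simp add: l_def M_def form_M_def)
  show "has_log_deriv form_M (4 * l + X) q"
    by (rule c[OF M[OF q]]) (simp add: l_def X_def form_X_def field_simps)
  show "has_log_deriv (\<lambda>q. form_X (q^7)) (4 * l' + N) q"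
    by (rule c[OF lift[OF X[OF q7]]]) (simp add: l'_def N_def form_M_def algebra_simps)
  show "has_log_deriv (\<lambda>q. form_M (q^7)) (4 * l' + Y) q"
    by (rule c[OF lift[OF M[OF q7]]]) (simp add: l'_def Y_def form_X_def field_simps)
qed

text \<open>Differentiates an identity with two terms on each side; the three-term modular equation
  is padded by the zero function.\<close>

lemma diff_has_log_deriv_unique:
  assumes "has_log_deriv f u q" "has_log_deriv g v q" "has_log_deriv h w q" "has_log_deriv k s q"
    and "open A" "q \<in> A" "\<And>x. x \<in> A \<Longrightarrow> f x + g x = h x + k x" "q \<noteq> 0"
  shows "f q * u + g q * v = h q * w + k q * s"
proof -
  note D = assms(1-4)[unfolded has_log_deriv_def]
  have "((\<lambda>x. h x + k x) has_field_derivative f q * u / q + g q * v / q) (at q)"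
    by (rule has_field_derivative_transform_within_open[OF DERIV_add[OF D(1,2)] assms(5,6)])
       (simp add: assms(7))
  then have "f q * u / q + g q * v / q = h q * w / q + k q * s / q"
    using DERIV_add[OF D(3,4)] DERIV_unique by blast
  then show ?thesis
    using assms(8) by (simp add: field_simps)
qed

text \<open>All three terms of the modular equation have l + l' in their logarithmic derivative, so
  this part cancels; phi(-q^2) phi(-q^14) is then eliminated as h - k.\<close>

lemma derived_equation:
  assumes q: "norm q < 1" "q \<noteq> 0"
  shows "mod_h q * (form_M q + 7 * form_M (q^7)) = mod_k q * (form_X q + 7 * form_X (q^7))"
proof -
  note d = log_derivs[OF q]
  have "mod_h q * (- 2 * lambert q + - 14 * lambert (q^7) + (form_M q + 7 * form_M (q^7)) / 4) + 0 * 0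
    = phi (- (q^2)) * phi (- ((q^7)^2)) * (- 2 * lambert q + - 14 * lambert (q^7) + (form_M q + 7 * form_M (q^7)) / 8)
      + mod_k q * (- 2 * lambert q + - 14 * lambert (q^7) + (form_M q + 7 * form_M (q^7) + form_X q + 7 * form_X (q^7)) / 8)"
    by (rule diff_has_log_deriv_unique[OF d(1) has_log_deriv_const[of 0] d(3,2), of "ball 0 1"])
       (use q mod_equation in auto)
  moreover have "phi (- (q^2)) * phi (- ((q^7)^2)) = mod_h q - mod_k q"
    using mod_equation[OF q(1)] by simp
  \<comment> \<open>The summand s disappears because its coefficients satisfy h = (h - k) +
    k.\<close>
  moreover have id: "h * A - k * B = 8 * ((h * (s + A / 4) + 0 * 0) - ((h - k) * (s + A / 8) + k * (s + (A + B) / 8)))"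
    for h k s A B :: complex
    by (simp add: field_simps)
  note id[of "mod_h q" "form_M q + 7 * form_M (q^7)" "mod_k q" "form_X q + 7 * form_X (q^7)"
      "- 2 * lambert q + - 14 * lambert (q^7)"]
  ultimately show ?thesis
    by (simp only: add.assoc) simp
qed

text \<open>The logarithmic derivatives of \<open>mod_h\<close> and \<open>mod_k\<close> enter
  multiplied by the equal quantities h (M + N) and k (X + Y), so only their difference (M + N - X -
  Y) / 8 remains of them. The terms in l and l' coming from the forms survive.\<close>

lemma second_derived_equation:
  assumes q: "norm q < 1" "q \<noteq> 0"
  defines "l \<equiv> - 2 * lambert q" and "l' \<equiv> - 14 * lambert (q^7)"
    and "X \<equiv> form_X q" and "M \<equiv> form_M q" and "Y \<equiv> 7 * form_X (q^7)" and "N \<equiv> 7 * form_M (q^7)"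
  shows "mod_k q * (X + Y) * (M + N - X - Y) / 8 + mod_h q * (M * (4 * l + X) + N * (4 * l' + Y))
      = mod_k q * (X * (4 * l + M) + Y * (4 * l' + N))"
proof -
  note d = log_derivs[OF q, folded l_def l'_def X_def M_def Y_def N_def]
  note d7 = has_log_deriv_mult[OF has_log_deriv_const[of 7] d(6)] has_log_deriv_mult[OF has_log_deriv_const[of 7] d(7)]
  have e: "mod_h x * form_M x + mod_h x * (7 * form_M (x^7)) = mod_k x * form_X x + mod_k x * (7 * form_X (x^7))"
    if "x \<in> ball 0 1 - {0}" for x
    using derived_equation[of x] that by (simp add: algebra_simps)
  have "mod_h q * M * (l + l' + (M + N) / 4 + (4 * l + X)) + mod_h q * N * (l + l' + (M + N) / 4 + (0 + (4 * l' + Y)))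
    = mod_k q * X * (l + l' + (M + N + X + Y) / 8 + (4 * l + M)) + mod_k q * Y * (l + l' + (M + N + X + Y) / 8 + (0 + (4 * l' + N)))"
    unfolding X_def M_def Y_def N_def
    by (rule diff_has_log_deriv_unique[OF has_log_deriv_mult[OF d(1,5)] has_log_deriv_mult[OF d(1) d7(2)]
          has_log_deriv_mult[OF d(2,4)] has_log_deriv_mult[OF d(2) d7(1)], unfolded X_def M_def Y_def N_def, of "ball 0 1 - {0}"])
       (use q e in \<open>auto intro!: open_Diff\<close>)
  moreover have "mod_h q * (M + N) = mod_k q * (X + Y)"
    unfolding X_def M_def Y_def N_def by (rule derived_equation[OF q])
  ultimately show ?thesis
    by (simp add: field_simps) algebra
qed

text \<open>Supplies the hypotheses of \<open>degree_7_algebra\<close>. Eighth powers of k and h - k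
  are taken since \<open>psi_square\<close>, \<open>phi_mult_phi_minus\<close> and
  \<open>jacobi_quartic\<close> then express them by X, M, Y, N and h; \<open>nz\<close> excludes
  degeneracy and the wrong sign.\<close>

lemma cubic_defect_generic:
  fixes q :: complex
  assumes q: "norm q < 1" "q \<noteq> 0"
  defines "t \<equiv> mod_k q / mod_h q"
  defines "d \<equiv> t * (1 - t) * (1 - t + t^2)"
  assumes nz: "d \<noteq> 0" "t * form_X q - form_M q \<noteq> 7 * mod_h q ^ 2 * d"
  shows "cubic_defect q = 0"
proof -
  have q7: "norm (q^7) < 1" "q^7 \<noteq> 0"
    using q norm_power7 by auto
  define h k where "h = mod_h q" and "k = mod_k q"
  define X M Y N where "X = form_X q" and "M = form_M q" and "Y = 7 * form_X (q^7)" and "N = 7 * form_M (q^7)"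
  note XMYN = X_def M_def Y_def N_def form_X_def form_M_def
  have h0: "h \<noteq> 0"
    using phi_nonzero[OF q(1)] phi_nonzero[OF q7(1)] by (simp add: h_def mod_h_def)
  have t: "t = k / h" "t * h = k"
    using h0 by (simp_all add: t_def h_def k_def)
  have psi8: "psi x ^ 8 = phi x ^ 4 * psi (x^2) ^ 4" if "norm x < 1" for x
    using arg_cong[OF psi_square[OF that], of "\<lambda>y. y ^ 4"] by (simp add: power_mult_distrib flip: power_mult)
  have MX: "M * X = 16 * q * psi q ^ 8" and NY: "N * Y = 784 * q^7 * psi (q^7) ^ 8"
    using psi8[OF q(1)] psi8[OF q7(1)] by (simp_all add: XMYN mult_ac)
  have k8: "k ^ 8 = 256 * q^8 * (psi q ^ 8 * psi (q^7) ^ 8)"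
    by (simp add: k_def mod_k_def power_mult_distrib)
  have MN: "7 * k ^ 8 = M * N * h ^ 4"
    unfolding k8 psi8[OF q(1)] psi8[OF q7(1)]
    by (simp add: XMYN h_def mod_h_def power_mult_distrib eval_nat_numeral)
  have hk: "h - k = phi (- (q^2)) * phi (- ((q^7)^2))"
    using mod_equation[OF q(1)] by (simp add: h_def k_def)
  have "(h - k) ^ 8 = (phi (- (q^2)) ^ 2 * phi (- ((q^7)^2)) ^ 2) ^ 4"
    unfolding hk by (simp only: power_mult_distrib power_mult[symmetric]) simp
  also have "\<dots> = h ^ 4 * (phi (-q) ^ 4 * phi (- (q^7)) ^ 4)"
    unfolding phi_mult_phi_minus[OF q(1), symmetric] phi_mult_phi_minus[OF q7(1), symmetric]
    by (simp add: h_def mod_h_def power_mult_distrib mult_ac)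
  also have "phi (-q) ^ 4 = X - M"
    using jacobi_quartic[OF q(1)] by (simp add: XMYN mult_ac)
  also have "phi (- (q^7)) ^ 4 = (Y - N) / 7"
    using jacobi_quartic[OF q7(1)] by (simp add: XMYN mult_ac)
  finally have hk8': "(h - k) ^ 8 = h ^ 4 * ((X - M) * ((Y - N) / 7))" .
  have hk8: "7 * (h - k) ^ 8 = h ^ 4 * ((X - M) * (Y - N))"
    unfolding hk8' by simp
  have "weight2 q ^ 3 + (t * h)^2 * weight2 q ^ 2 - 3 / 16 * (t * h)^4 * weight2 q
      - (t * h)^2 / 64 * (M * X + N * Y + 4 * (t * h)^4) = 0"
  proof (rule degree_7_algebra)
    have "h * (M + N) = k * (X + Y)"
      unfolding h_def k_def X_def M_def Y_def N_def by (rule derived_equation[OF q])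
    then show "M + N = t * (X + Y)"
      using h0 by (simp add: t(1) field_simps)
    show "X * Y = 7 * h^4"
      by (simp add: XMYN h_def mod_h_def power_mult_distrib)
    show "M * N = 7 * t^8 * h^4"
    proof -
      have "7 * t^8 * h^4 = 7 * k^8 / h^4"
        using h0 by (simp add: t(1) power_divide eval_nat_numeral)
      then show ?thesis
        unfolding MN using h0 by simp
    qed
    show "(X - M) * (Y - N) = 7 * (1 - t)^8 * h^4"
    proof -
      have "1 - t = (h - k) / h"
        using h0 by (simp add: t(1) field_simps)
      then have "7 * (1 - t)^8 * h^4 = 7 * (h - k)^8 / h^4"
        using h0 by (simp add: power_divide eval_nat_numeral)
      then show ?thesis
        unfolding hk8 using h0 by simp
    qed
    let ?l = "- 2 * lambert q" and ?l' = "- 14 * lambert (q^7)"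
    have "k * (X + Y) * (M + N - X - Y) / 8 + h * (M * (4 * ?l + X) + N * (4 * ?l' + Y))
      = k * (X * (4 * ?l + M) + Y * (4 * ?l' + N))"
      unfolding h_def k_def X_def M_def Y_def N_def by (rule second_derived_equation[OF q])
    then have "h * (t * (X + Y) * (M + N - X - Y) / 8 + (M * (4 * ?l + X) + N * (4 * ?l' + Y)))
      = h * (t * (X * (4 * ?l + M) + Y * (4 * ?l' + N)))"
      unfolding t(2)[symmetric] by (simp add: algebra_simps)
    then show "t * (X + Y) * (M + N - X - Y) / 8 + (M * (4 * ?l + X) + N * (4 * ?l' + Y))
      = t * (X * (4 * ?l + M) + Y * (4 * ?l' + N))"
      using h0 by (simp only: mult_cancel_left) simp
    show "weight2 q = (?l' - ?l) / 2"
      by (simp add: weight2_def)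
    show "h \<noteq> 0" by (rule h0)
    show "t * (1 - t) * (1 - t + t^2) \<noteq> 0" "t * X - M \<noteq> 7 * h^2 * (t * (1 - t) * (1 - t + t^2))"
      using nz by (simp_all add: d_def h_def X_def M_def)
  qed
  then show ?thesis
    unfolding t(2) MX NY by (simp add: cubic_defect_def k_def)
qed

section \<open>Behaviour at the origin and analytic continuation\<close>

lemma theta_at_0: "phi 0 = 1" "psi 0 = 1"
proof -
  have "phi 0 = (\<Sum>\<^sub>\<infinity>n\<in>{0::int}. 1)"
    unfolding phi_def by (rule infsum_cong_neutral) (auto simp: power_0_left)
  then show "phi 0 = 1" by simp
  \<comment> \<open>Since 0^0 = 1, the two indices 0 and -1 with exponent 0 each contribute
    1.\<close>
  have "(\<Sum>\<^sub>\<infinity>n::int. (0::complex) ^ nat (n * (n + 1) div 2)) = (\<Sum>\<^sub>\<infinity>n\<in>{0::int, -1}. 1)"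
  proof (rule infsum_cong_neutral)
    fix n :: int assume "n \<in> UNIV - {0, -1}"
    then have "n * (n + 1) \<noteq> 0" by auto
    then have "n * (n + 1) div 2 > 0"
      using two_tri(1)[of n] tri_nonneg(1)[of n] by linarith
    then show "(0::complex) ^ nat (n * (n + 1) div 2) = 0"
      by (simp add: power_0_left)
  qed auto
  then show "psi 0 = 1"
    by (simp add: psi_def)
qed

text \<open>The quantities that must not vanish tend to 0 with q, so each is divided by q and given
  a nonzero limit.\<close>

lemma cubic_defect_near_0: "\<forall>\<^sub>F q in at 0. cubic_defect q = 0"
proof -
  have c: "(phi \<longlongrightarrow> 1) (at 0)" "(psi \<longlongrightarrow> 1) (at 0)"
    using field_differentiable_imp_continuous_at[OF phi_differentiable[of 0]]
      field_differentiable_imp_continuous_at[OF psi_differentiable[of 0]] by (simp_all add: isCont_def theta_at_0)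
  have p: "filterlim (\<lambda>q::complex. q ^ n) (at 0) (at 0)" if "n > 0" for n
    unfolding filterlim_at
  proof
    show "\<forall>\<^sub>F q::complex in at 0. q ^ n \<in> UNIV \<and> q ^ n \<noteq> 0"
      unfolding eventually_at_filter by (auto intro!: always_eventually)
    show "((\<lambda>q::complex. q ^ n) \<longlongrightarrow> 0) (at 0)"
      using that by (auto intro!: tendsto_eq_intros)
  qed
  have c': "((\<lambda>q. phi (q^7)) \<longlongrightarrow> 1) (at 0)" "((\<lambda>q. psi (q^7)) \<longlongrightarrow> 1) (at 0)" "((\<lambda>q. psi (q^2)) \<longlongrightarrow> 1) (at 0)"
    by (rule filterlim_compose[OF c(1) p] filterlim_compose[OF c(2) p], simp)+
  \<comment> \<open>T, G, F are t, d and t X - M - 7 h^2 d, each divided by q. T and G tend to 2, F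
    to 2 - 16 - 14 = -28; the opposite sign of the last term would give 0, so this is where the sign
    is decided.\<close>
  define T where "T q = 2 * psi q * psi (q^7) / mod_h q" for q
  define G where "G q = T q * (1 - q * T q) * (1 - q * T q + (q * T q)^2)" for q
  define F where "F q = T q * form_X q - 16 * psi (q^2) ^ 4 - 7 * mod_h q ^ 2 * G q" for q
  have h: "(mod_h \<longlongrightarrow> 1 * 1) (at 0)"
    unfolding mod_h_def[abs_def] by (intro tendsto_intros c c')
  have T: "(T \<longlongrightarrow> 2 * 1 * 1 / (1 * 1)) (at 0)"
    unfolding T_def[abs_def] by (intro tendsto_intros c c' h) auto
  have qT: "((\<lambda>q. q * T q) \<longlongrightarrow> 0) (at 0)"
    using tendsto_mult[OF tendsto_ident_at T] by simp
  have G: "(G \<longlongrightarrow> (2 * 1 * 1 / (1 * 1)) * (1 - 0) * (1 - 0 + 0^2)) (at 0)"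
    unfolding G_def[abs_def] by (intro tendsto_intros T qT)
  have F: "(F \<longlongrightarrow> (2 * 1 * 1 / (1 * 1)) * 1^4 - 16 * 1^4 - 7 * (1 * 1)^2 * ((2 * 1 * 1 / (1 * 1)) * (1 - 0) * (1 - 0 + 0^2))) (at 0)"
    unfolding F_def[abs_def] form_X_def by (intro tendsto_intros T G h c c')
  have "\<forall>\<^sub>F q in at 0. G q \<noteq> 0"
    by (rule tendsto_imp_eventually_ne[OF G]) simp
  moreover have "\<forall>\<^sub>F q in at 0. F q \<noteq> 0"
    by (rule tendsto_imp_eventually_ne[OF F]) simp
  moreover have "\<forall>\<^sub>F q::complex in at 0. q \<in> ball 0 1 - {0}"
    by (rule eventually_at_in_open) auto
  ultimately show ?thesis
  proof eventually_elim
    case (elim q)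
    have t: "mod_k q / mod_h q = q * T q"
      by (simp add: T_def mod_k_def)
    have "q * F q \<noteq> 0"
      using elim by simp
    moreover have "q * F q = q * T q * form_X q - form_M q - 7 * mod_h q ^ 2 * (q * T q * (1 - q * T q) * (1 - q * T q + (q * T q)^2))"
      by (simp add: F_def G_def form_M_def algebra_simps)
    moreover have "q * G q \<noteq> 0"
      using elim by simp
    ultimately show "cubic_defect q = 0"
      using elim by (intro cubic_defect_generic) (auto simp: t G_def mult.assoc)
  qed
qed

text \<open>Read off from \<open>phi_minus_logderiv\<close>, since phi(-q) is holomorphic without
  zeros in the disc; at q = 0 both sides are 0.\<close>

lemma lambert_holomorphic: "lambert holomorphic_on ball 0 1"
proof -
  have hm: "(\<lambda>q. phi (-q)) holomorphic_on ball 0 1"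
  proof -
    have "phi \<circ> uminus holomorphic_on ball 0 1"
      by (rule holomorphic_on_compose_gen[OF _ phi_holomorphic]) (auto intro!: holomorphic_intros)
    then show ?thesis by (simp add: o_def)
  qed
  have quot: "(\<lambda>q. - (q * deriv (\<lambda>q. phi (-q)) q) / (2 * phi (-q))) holomorphic_on ball 0 1"
    using phi_minus_nonzero by (intro holomorphic_intros hm) auto
  have eq: "lambert q = - (q * deriv (\<lambda>q. phi (-q)) q) / (2 * phi (-q))" if "q \<in> ball 0 1" for q
  proof (cases "q = 0")
    case True
    then show ?thesis by (simp add: lambert_def)
  next
    case False
    then show ?thesis
      using phi_minus_logderiv[of q] phi_minus_nonzero[of q] that by simp
  qed
  have "lambert holomorphic_on ball 0 1 \<longleftrightarrow>
      (\<lambda>q. - (q * deriv (\<lambda>q. phi (-q)) q) / (2 * phi (-q))) holomorphic_on ball 0 1"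
    by (rule holomorphic_cong[OF refl]) (rule eq)
  then show ?thesis
    using quot by (rule iffD2)
qed

lemma cubic_defect_zero:
  assumes "norm q < 1"
  shows "cubic_defect q = 0"
proof -
  have p7: "f \<circ> (\<lambda>q. q^7) holomorphic_on ball 0 1" if "f holomorphic_on ball 0 1" for f :: "complex \<Rightarrow> complex"
    by (rule holomorphic_on_compose_gen[OF _ that]) (auto intro!: holomorphic_intros norm_power7)
  note h = p7[OF lambert_holomorphic, unfolded o_def] p7[OF psi_holomorphic, unfolded o_def]
  have hol: "cubic_defect holomorphic_on ball 0 1"
    unfolding cubic_defect_def[abs_def] weight2_def mod_k_def
    by (intro holomorphic_intros h lambert_holomorphic psi_holomorphic) auto
  obtain e where e: "e > 0" "\<And>q. q \<noteq> 0 \<Longrightarrow> dist q 0 < e \<Longrightarrow> cubic_defect q = 0"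
    using cubic_defect_near_0 unfolding eventually_at by auto
  define U where "U = ball 0 (min e 1) - {0 :: complex}"
  show ?thesis
  proof (rule analytic_continuation[OF hol, of U 0])
    show "0 islimpt U"
      unfolding U_def islimpt_def
    proof safe
      fix S :: "complex set" assume "0 \<in> S" "open S"
      then obtain r where r: "r > 0" "ball 0 r \<subseteq> S"
        using openE by blast
      define x where "x = complex_of_real (min r (min e 1) / 2)"
      have "x \<noteq> 0" "norm x < r" "norm x < min e 1"
        using r(1) e(1) by (auto simp: x_def)
      then show "\<exists>y\<in>ball 0 (min e 1) - {0}. y \<in> S \<and> y \<noteq> 0"
        using r(2) by (intro bexI[of _ x]) auto
    qed
    show "cubic_defect z = 0" if "z \<in> U" for z
      using that e(2)[of z] by (auto simp: U_def)
  qed (use assms in \<open>auto simp: U_def\<close>)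
qed

theorem theorem1p1:
  fixes \<tau> z :: complex
  assumes "Im \<tau> > 0"
  assumes "z = z_fun \<tau>"
  shows "z^3 + 4 * (Pi_q \<tau> / Pi_q7 \<tau>) * z^2 - 3 * ((Pi_q \<tau>)^2 / (Pi_q7 \<tau>)^2) * z
         - (Pi_q \<tau> / Pi_q7 \<tau>) *
             ((Pi_q \<tau>)^4 / (Pi_q7 \<tau>)^4 + 4 * ((Pi_q \<tau>)^2 / (Pi_q7 \<tau>)^2) + 49) = 0"
proof -
  define q where "q = q_power \<tau> 1"
  \<comment> \<open>One fourth root carries both prefactors, as q^(7/4) = e^7; in A B, A^4 and B^4
    it enters only through e^4 = q.\<close>
  define e where "e = q_power \<tau> (1/4)"
  define A B W where "A = Pi_q \<tau>" and "B = Pi_q7 \<tau>" and "W = weight2 q"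
  have q0: "q \<noteq> 0"
    by (simp add: q_def q_power_def)
  have q1: "norm q < 1"
    using assms(1) by (simp add: q_def q_power_def norm_exp_eq_Re mult_pos_pos)
  note q7 = norm_power7[OF q1]
  have e4: "e ^ 4 = q"
    by (simp add: e_def q_def q_power_def flip: exp_of_nat_mult) (simp add: of_rat_divide mult_ac)
  have e7: "q_power \<tau> (7/4) = e ^ 7"
    by (simp add: e_def q_power_def flip: exp_of_nat_mult) (simp add: of_rat_divide mult_ac)
  have quot: "qpoch_inf (x^2) (x^2) ^ 2 / qpoch_inf x (x^2) ^ 2 = psi x ^ 2" if "norm x < 1" "x \<noteq> 0" for x
  proof -
    have x2: "norm (x^2) < 1"
      using that by (auto intro: norm_power_less_1)
    have "psi x * qpoch_inf x (x^2) * qpoch_inf (x^2) (x^2) = qpoch_inf (x^2) (x^2) * qpoch_inf (x^2) (x^2)"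
      using psi_eq[OF that] unfolding euler_split_odd[OF that(1)] by (simp add: power2_eq_square mult.assoc)
    then have "psi x * qpoch_inf x (x^2) = qpoch_inf (x^2) (x^2)"
      using euler_nonzero[OF x2] by simp
    moreover have "qpoch_inf x (x^2) \<noteq> 0"
      using euler_nonzero[OF that(1)] unfolding euler_split_odd[OF that(1)] by auto
    ultimately have "qpoch_inf (x^2) (x^2) / qpoch_inf x (x^2) = psi x"
      by (simp add: field_simps)
    then show ?thesis
      by (simp flip: power_divide)
  qed
  have A: "A = e * psi q ^ 2"
    using quot[OF q1 q0] by (simp add: A_def Pi_q_def Let_def flip: q_def e_def times_divide_eq_right)
  have B: "B = e ^ 7 * psi (q^7) ^ 2"
    using quot[OF q7] q0 by (simp add: B_def Pi_q7_def Let_def e7 flip: q_def times_divide_eq_right power_mult)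
  have B0: "B \<noteq> 0"
    using psi_nonzero[OF q7] q0 e4 unfolding B by auto
  have z: "z = W / B^2"
  proof -
    \<comment> \<open>Identifies the second series of z as the first one at q^7.\<close>
    have "14 * Suc n - 7 = 7 * (2 * Suc n - 1)" for n
      by simp
    then have "q ^ (14 * Suc n - 7) = (q^7) ^ (2 * Suc n - 1)" for n
      by (simp only: power_mult)
    then show ?thesis
      unfolding assms(2) z_fun_def Let_def q_def[symmetric] B_def[symmetric]
      by (simp only: W_def weight2_def lambert_def) simp
  qed
  have k2: "mod_k q ^ 2 = 4 * (A * B)" and A4: "A ^ 4 = q * psi q ^ 8" and B4: "B ^ 4 = q^7 * psi (q^7) ^ 8"
    unfolding mod_k_def A B e4[symmetric] by (simp_all add: power_mult_distrib flip: power_mult power_add) (simp add: eval_nat_numeral)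
  have "mod_k q ^ 4 = 16 * (A * B)^2"
    using arg_cong[OF k2, of "\<lambda>x. x^2"] by (simp add: power_mult_distrib flip: power_mult)
  with cubic_defect_zero[OF q1] have "W^3 + 4 * (A * B) * W^2 - 3 / 16 * (16 * (A * B)^2) * W
     - 4 * (A * B) / 64 * (16 * A^4 + 784 * B^4 + 4 * (16 * (A * B)^2)) = 0"
    unfolding cubic_defect_def k2 A4 B4 W_def[symmetric] by (simp only: mult.assoc)
  then have *: "W^3 + 4 * A * B * W^2 - 3 * A^2 * B^2 * W - A * B * (A^4 + 4 * A^2 * B^2 + 49 * B^4) = 0"
    by (simp add: algebra_simps power_mult_distrib)
  \<comment> \<open>With z = W / B^2 all terms acquire the common denominator B^6.\<close>
  have "z^3 + 4 * (A / B) * z^2 - 3 * (A^2 / B^2) * z - (A / B) * (A^4 / B^4 + 4 * (A^2 / B^2) + 49)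
     = (W^3 + 4 * A * B * W^2 - 3 * A^2 * B^2 * W - A * B * (A^4 + 4 * A^2 * B^2 + 49 * B^4)) / B^6"
    unfolding z using B0 by (simp add: divide_simps) algebra
  then show ?thesis
    unfolding * by (simp add: A_def B_def)
qed

end
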